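(* For any $d\ge 2$, there exists a faithful doubly minimal action of $\mathbb{Z}^d$ on the Cantor set.
   Context: An action $T$ of $\mathbb{Z}^d$ by homeomorphisms on a compact metric space $X$ is doubly minimal if $X$ is infinite and for every two points $x_1,x_2\in X$ lying in different $\mathbb{Z}^d$-orbits, the orbit $\{(T^gx_1,T^gx_2):g\in\mathbb{Z}^d\}$ is dense in $X\times X$. It is faithful if $T^g\ne\mathrm{id}_X$ for every $g\in\mathbb{Z}^d\setminus\{0\}$. *)

theory Defs
  imports "HOL-Analysis.Analysis"
begin

text \<open>
  The group \<open>\<int>\<^sup>d\<close> is the additive group \<open>int ^ 'd\<close> with \<open>d = CARD('d)\<close>. A system lives on a subset
  \<open>X\<close> of a metric space type, so only the values of \<open>T g\<close> on \<open>X\<close> matter.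
\<close>

definition homeo_action :: "(int ^ 'd \<Rightarrow> 'a \<Rightarrow> 'a) \<Rightarrow> 'a::metric_space set \<Rightarrow> bool" where
  "homeo_action T X \<longleftrightarrow>
     (\<forall>g. \<exists>S. homeomorphism X X (T g) S) \<and>
     (\<forall>x\<in>X. T 0 x = x) \<and>
     (\<forall>g h. \<forall>x\<in>X. T (g + h) x = T g (T h x))"

definition action_orbit :: "(int ^ 'd \<Rightarrow> 'a \<Rightarrow> 'a) \<Rightarrow> 'a \<Rightarrow> 'a set" where
  "action_orbit T x = range (\<lambda>g. T g x)"

definition doubly_minimal :: "(int ^ 'd \<Rightarrow> 'a \<Rightarrow> 'a) \<Rightarrow> 'a::metric_space set \<Rightarrow> bool" where
  "doubly_minimal T X \<longleftrightarrow>
     compact X \<and> homeo_action T X \<and> infinite X \<and>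
     (\<forall>x1\<in>X. \<forall>x2\<in>X. action_orbit T x1 \<noteq> action_orbit T x2 \<longrightarrow>
        X \<times> X \<subseteq> closure (range (\<lambda>g. (T g x1, T g x2))))"

definition faithful_action :: "(int ^ 'd \<Rightarrow> 'a \<Rightarrow> 'a) \<Rightarrow> 'a set \<Rightarrow> bool" where
  "faithful_action T X \<longleftrightarrow> (\<forall>g. g \<noteq> 0 \<longrightarrow> \<not> (\<forall>x\<in>X. T g x = x))"

text \<open>
  The middle-thirds Cantor set: the reals in \<open>[0, 1]\<close> having a ternary expansion with digits 0
  and 2 only.
\<close>

definition cantor_set :: "real set" where
  "cantor_set = {x. \<exists>a :: nat \<Rightarrow> real. (\<forall>n. a n \<in> {0, 2}) \<and> (\<lambda>n. a n / 3 ^ Suc n) sums x}"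

end

theory Submission
  imports Defs "HOL-Number_Theory.Cong"
begin

text \<open>
  The system is a rank-one tiling of \<open>\<int>\<^sup>d\<close> without spacers. Start from the standard grid of cubes of side
  \<open>8193\<^sup>n\<^sup>+\<^sup>1\<close> for every level \<open>n\<close>; in each cube of level \<open>n + 1\<close> finitely many small boxes are cut
  out, and inside a box the grids of the levels \<open>\<le> n\<close> are slid by some \<open>Y n s\<close> along one axis. Every
  position then has a phase modulo \<open>8193\<^sup>n\<^sup>+\<^sup>1\<close> at every level \<open>n\<close>, and the space is the orbit closure of this
  phase function.

  Boxes of different levels are far apart, so a window comparable to the level \<open>n\<close> cubes meets at most
  one box boundary of level \<open>\<ge> n\<close>. Two points therefore have a well defined offset modulo
  \<open>8193\<^sup>n\<^sup>+\<^sup>1\<close> in many windows. If the offset is not nearly zero at level \<open>n + 1\<close>, then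
  boxes of the first point lie over undisplaced parts of the second one, so the offset modulo the next
  smaller cube size can be changed by \<open>Y n s\<close> in any direction; there are three boxes for each
  direction, with \<open>Y n s\<close> congruent modulo all smaller sizes, hence the new offset can again be kept away from
  zero. As \<open>Y n s\<close> is a unit modulo \<open>8193\<close>, all offsets occur at every level, which makes the orbit of the pair
  dense. If on the other hand all offsets are nearly zero from some level on, then the box boundaries of
  both points coincide, since \<open>Y n s\<close> is never nearly zero, and one point is a translate of the other.
\<close>

section \<open>Phases and boxes\<close>

definition q :: "nat \<Rightarrow> int" where "q n = 8193 ^ n"

lemma q_Suc: "q (Suc n) = 8193 * q n"
  by (simp add: q_def)

lemma q_pos: "0 < q n"
  by (simp add: q_def)

lemma q_gt: "int n < q n"
proof (induction n)
  case (Suc n)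
  then show ?case using q_pos[of n] by (simp add: q_Suc)
qed (simp add: q_def)

lemma q_dvd: "m \<le> n \<Longrightarrow> q m dvd q n"
  by (simp add: q_def le_imp_power_dvd)

lemma q_mono: "m \<le> n \<Longrightarrow> q m \<le> q n"
  by (simp add: q_def power_increasing)

text \<open>Phases of level \<open>n\<close> count modulo \<open>q (Suc n)\<close>, the side of a
  level \<open>n\<close> cube. Thus \<open>q n\<close> is the side of the next smaller cubes, and
  \<open>q 0 = 1\<close> the unit of length.\<close>

definition vcong :: "nat \<Rightarrow> int ^ 'd \<Rightarrow> int ^ 'd \<Rightarrow> bool" where
  "vcong n a b \<longleftrightarrow> (\<forall>k. [a $ k = b $ k] (mod q (Suc n)))"

lemma vcong_refl [simp]: "vcong n a a"
  by (simp add: vcong_def)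

lemma vcong_sym: "vcong n a b \<Longrightarrow> vcong n b a"
  by (simp add: vcong_def cong_sym)

lemma vcong_trans: "vcong n a b \<Longrightarrow> vcong n b c \<Longrightarrow> vcong n a c"
  unfolding vcong_def using cong_trans by blast

lemma vcong_add: "vcong n a b \<Longrightarrow> vcong n c d \<Longrightarrow> vcong n (a + c) (b + d)"
  by (simp add: vcong_def cong_add)

lemma vcong_diff: "vcong n a b \<Longrightarrow> vcong n c d \<Longrightarrow> vcong n (a - c) (b - d)"
  by (simp add: vcong_def cong_diff)

lemma vcong_le: "vcong n a b \<Longrightarrow> m \<le> n \<Longrightarrow> vcong m a b"
  unfolding vcong_def by (meson Suc_le_mono cong_dvd_modulus q_dvd)

lemma mod_shift:
  fixes x d M :: int
  assumes "0 \<le> x mod M + d" "x mod M + d < M"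
  shows "(x + d) mod M = x mod M + d"
  using assms by (metis mod_add_left_eq mod_pos_pos_trivial)

text \<open>
  The box \<open>(c, s)\<close> of step \<open>n\<close> has side \<open>32 * q (Suc n)\<close>. The positions are chosen such that a translate
  of the boxes can cover parts of at most one of the three boxes of direction \<open>c\<close>, apart from boxes
  with the same index.
\<close>

definition boxpos :: "'d \<Rightarrow> nat \<Rightarrow> 'd \<Rightarrow> int" where
  "boxpos c s k = 2048 + (if k = c then 128 * 2 ^ s else 0)"

definition inbox :: "nat \<Rightarrow> 'd \<Rightarrow> nat \<Rightarrow> int ^ 'd \<Rightarrow> bool" where
  "inbox n c s \<theta> \<longleftrightarrow> (\<forall>k. boxpos c s k * q (Suc n) \<le> \<theta> $ k mod q (Suc (Suc n)) \<and>
     \<theta> $ k mod q (Suc (Suc n)) < (boxpos c s k + 32) * q (Suc n))"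

text \<open>
  \<open>Y n s\<close> is the displacement inside the boxes of step \<open>n\<close>. Modulo \<open>q (Suc l)\<close> with \<open>l < n\<close> it is \<open>V l\<close>,
  independently of \<open>s\<close>, and it is at least \<open>8 * q l\<close> away from zero there.
\<close>

fun V :: "nat \<Rightarrow> int" where
  "V 0 = 8"
| "V (Suc n) = V n + 8 * q (Suc n)"

definition Y :: "nat \<Rightarrow> nat \<Rightarrow> int" where
  "Y n s = V n + 16 * int s * q n"

text \<open>The boxes are pairwise disjoint by \<open>inbox_unique\<close>, so at most one summand
  in at most one coordinate is nonzero; the sum merely avoids choosing a box.\<close>

definition disp :: "nat \<Rightarrow> int ^ 'd \<Rightarrow> int ^ 'd" where
  "disp n \<theta> = (\<chi> k. \<Sum>s<3. if inbox n k s \<theta> then Y n s else 0)"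

text \<open>Turns the phase of level \<open>n + 1\<close> at a position into its phase of level
  \<open>n\<close>, correcting for the displacement inside the boxes.\<close>

definition step :: "nat \<Rightarrow> int ^ 'd \<Rightarrow> int ^ 'd" where
  "step n \<theta> = \<theta> + disp n \<theta>"

lemma V_bounds: "8 * q n \<le> V n \<and> V n \<le> 9 * q n"
proof (induction n)
  case (Suc n)
  then show ?case using q_pos[of n] by (simp add: q_Suc)
qed (simp add: q_def)

lemma Y_bounds: assumes "s < 3" shows "8 * q n \<le> Y n s \<and> Y n s \<le> 41 * q n"
proof -
  have "s = 0 \<or> s = 1 \<or> s = 2" using assms by auto
  \<comment> \<open>The constant 41 is 9 + 16 * 2, attained by the largest index
    \<open>s = 2\<close>.\<close>
  then show ?thesis using V_bounds[of n] q_pos[of n] by (auto simp: Y_def)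
qed

text \<open>Each new summand \<open>8 * q (Suc n)\<close> is a multiple of every modulus
  \<open>q (Suc l)\<close> with \<open>l \<le> n\<close>.\<close>

lemma V_cong: "l \<le> n \<Longrightarrow> [V n = V l] (mod q (Suc l))"
proof (induction n)
  case (Suc n)
  show ?case
  proof (cases "l = Suc n")
    case False
    then have "l \<le> n" using Suc.prems by simp
    moreover have "q (Suc l) dvd 8 * q (Suc n)" using \<open>l \<le> n\<close> by (simp add: q_dvd)
    ultimately show ?thesis using Suc.IH
      by (metis V.simps(2) add.right_neutral cong_0_iff cong_add)
  qed simp
qed simp

lemma Y_cong: "l < n \<Longrightarrow> [Y n s = V l] (mod q (Suc l))"
proof -
  assume "l < n"
  then have "q (Suc l) dvd 16 * int s * q n" by (simp add: q_dvd)
  then show ?thesis unfolding Y_def using V_cong[of l n] \<open>l < n\<close>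
    by (metis add.right_neutral cong_0_iff cong_add less_imp_le)
qed

text \<open>Modulo 8193 only the initial summand 8 of \<open>V n\<close> survives, and 8193 is
  odd.\<close>

lemma V_coprime: "coprime (V n) (q m)"
proof -
  have "[V n = 8] (mod q (Suc 0))" using V_cong[of 0 n] by simp
  then have "[V n = 8] (mod 8193)" by (simp add: q_def)
  moreover have "coprime (8::int) 8193" using gcd_red_int[of 8193 8] by (simp add: coprime_iff_gcd_eq_1 gcd.commute)
  ultimately have "coprime (V n) 8193" by (metis cong_imp_coprime cong_sym)
  then show ?thesis by (simp add: q_def)
qed

section \<open>Disjointness of the boxes and the displacement\<close>

lemma less3: "(s::nat) < 3 \<longleftrightarrow> s = 0 \<or> s = 1 \<or> s = 2" by auto

lemma boxpos_bounds: "s < 3 \<Longrightarrow> 2048 \<le> boxpos c s k \<and> boxpos c s k \<le> 2560"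
  by (auto simp: boxpos_def less3)

text \<open>Along its own axis a box is moved by 128, 256 or 512 away from 2048, so boxes with
  different indices are at least 128 apart in coordinate \<open>c\<close> or
  \<open>e\<close>.\<close>

lemma boxpos_inj:
  assumes "s < 3" "t < 3" "\<And>k. \<bar>boxpos c s k - boxpos e t k\<bar> < 128"
  shows "c = e \<and> s = t"
  using assms(1,2) assms(3)[of c] assms(3)[of e]
  by (auto simp: boxpos_def less3 split: if_splits)

lemma inbox_unique:
  assumes "inbox n c s \<theta>" "inbox n e t \<theta>" "s < 3" "t < 3"
  shows "c = e \<and> s = t"
proof (rule boxpos_inj[OF assms(3,4)])
  fix k
  have "boxpos c s k * q (Suc n) < (boxpos e t k + 32) * q (Suc n)"
    "boxpos e t k * q (Suc n) < (boxpos c s k + 32) * q (Suc n)"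
    using assms(1,2) unfolding inbox_def by (meson le_less_trans)+
  then show "\<bar>boxpos c s k - boxpos e t k\<bar> < 128"
    using q_pos[of "Suc n"] by (auto simp: mult_less_cancel_right)
qed

lemma disp_inbox:
  assumes "inbox n c s \<theta>" "s < 3"
  shows "disp n \<theta> = axis c (Y n s)"
proof -
  have "(\<Sum>t<3. if inbox n k t \<theta> then Y n t else 0) = (if k = c then Y n s else 0)" for k
  proof (cases "k = c")
    case True
    have "(\<Sum>t<3. if inbox n k t \<theta> then Y n t else 0) = (\<Sum>t<3. if t = s then Y n t else 0)"
    proof (rule sum.cong)
      fix t :: nat assume "t \<in> {..<3}"
      then have "inbox n k t \<theta> \<longleftrightarrow> t = s"
        using True assms inbox_unique[OF assms(1) _ assms(2), of k t] by auto
      then show "(if inbox n k t \<theta> then Y n t else 0) = (if t = s then Y n t else 0)" by simp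
    qed simp
    then show ?thesis using True assms by simp
  next
    case False
    then have "\<not> inbox n k t \<theta>" if "t < 3" for t using that assms inbox_unique by blast
    then show ?thesis using False by simp
  qed
  then show ?thesis by (auto simp: disp_def axis_def vec_eq_iff)
qed

lemma disp_notin: "(\<And>c s. s < 3 \<Longrightarrow> \<not> inbox n c s \<theta>) \<Longrightarrow> disp n \<theta> = 0"
  by (simp add: disp_def vec_eq_iff)

lemma disp_vcong: "vcong (Suc n) \<theta> \<eta> \<Longrightarrow> disp n \<theta> = disp n \<eta>"
  by (simp add: disp_def inbox_def vcong_def cong_def)

lemma step_vcong: "vcong (Suc n) \<theta> \<eta> \<Longrightarrow> vcong n (step n \<theta>) (step n \<eta>)"
  unfolding step_def by (metis disp_vcong vcong_add vcong_le vcong_refl lessI less_imp_le)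

text \<open>In every coordinate all boxes lie in the band from 2048 to 2592 = 2560 + 32, so a single
  coordinate outside this band suffices.\<close>

lemma not_inbox_coord:
  assumes "s < 3" "\<theta> $ k mod q (Suc (Suc n)) < 2048 * q (Suc n) \<or> 2592 * q (Suc n) \<le> \<theta> $ k mod q (Suc (Suc n))"
  shows "\<not> inbox n c s \<theta>"
proof
  assume "inbox n c s \<theta>"
  then have *: "boxpos c s k * q (Suc n) \<le> \<theta> $ k mod q (Suc (Suc n))"
     "\<theta> $ k mod q (Suc (Suc n)) < (boxpos c s k + 32) * q (Suc n)" by (auto simp: inbox_def)
  have "2048 * q (Suc n) \<le> boxpos c s k * q (Suc n)" "(boxpos c s k + 32) * q (Suc n) \<le> 2592 * q (Suc n)"
    using boxpos_bounds[OF assms(1), of c k] q_pos[of "Suc n"] by (simp_all add: mult_right_mono)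
  then show False using * assms(2) by linarith
qed

text \<open>Walls of the level \<open>n + 1\<close> grid stay clear of the boxes: within 2000 units
  of a wall the residue is at most 2000 or at least 8193 - 2000, both outside the band of the
  boxes.\<close>

lemma disp_near:
  fixes \<theta> :: "int ^ 'd"
  assumes "- (2000 * q (Suc n)) \<le> \<theta> $ k - q (Suc (Suc n)) * m" "\<theta> $ k - q (Suc (Suc n)) * m \<le> 2000 * q (Suc n)"
  shows "disp n \<theta> = 0"
proof (rule disp_notin, rule not_inbox_coord[where k = k])
  fix c :: 'd and s :: nat assume "s < 3" then show "s < 3" .
  let ?x = "\<theta> $ k - q (Suc (Suc n)) * m"
  have e: "\<theta> $ k mod q (Suc (Suc n)) = ?x mod q (Suc (Suc n))"
    by (simp add: mod_diff_right_eq[symmetric])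
  have Q: "q (Suc (Suc n)) = 8193 * q (Suc n)" by (rule q_Suc)
  show "\<theta> $ k mod q (Suc (Suc n)) < 2048 * q (Suc n) \<or> 2592 * q (Suc n) \<le> \<theta> $ k mod q (Suc (Suc n))"
  proof (cases "?x \<ge> 0")
    case True
    then have "?x mod q (Suc (Suc n)) = ?x"
      using assms q_pos[of "Suc n"] unfolding Q by (intro mod_pos_pos_trivial) auto
    then show ?thesis using e assms q_pos[of "Suc n"] by linarith
  next
    case False
    have "?x mod q (Suc (Suc n)) = (?x + q (Suc (Suc n))) mod q (Suc (Suc n))" by simp
    also have "\<dots> = ?x + q (Suc (Suc n))"
      using assms False q_pos[of "Suc n"] unfolding Q by (intro mod_pos_pos_trivial) auto
    finally show ?thesis using e assms q_pos[of "Suc n"] unfolding Q by linarith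
  qed
qed

section \<open>Descent through the levels and the base point\<close>

fun desc :: "nat \<Rightarrow> nat \<Rightarrow> int ^ 'd \<Rightarrow> int ^ 'd" where
  "desc n 0 \<theta> = \<theta>"
| "desc n (Suc j) \<theta> = step n (desc (Suc n) j \<theta>)"

lemma desc_top: "desc n (Suc j) \<theta> = desc n j (step (n + j) \<theta>)"
proof (induction j arbitrary: n)
  case (Suc j)
  show ?case using Suc.IH[of "Suc n"] by simp
qed simp

text \<open>The origin is a vertex of every grid. At levels whose cubes are large compared with
  \<open>u\<close>, \<open>disp_near\<close> with \<open>m = 0\<close> makes all further top steps
  trivial.\<close>

lemma desc_stable:
  assumes "\<And>k. \<bar>u $ k\<bar> \<le> 2000 * q (Suc (n + j))"
  shows "desc n (j + i) u = desc n j u"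
proof (induction i)
  case (Suc i)
  have "q (Suc (n + j)) \<le> q (Suc (n + (j + i)))" by (simp add: q_mono)
  then have "\<bar>u $ k\<bar> \<le> 2000 * q (Suc (n + (j + i)))" for k using assms[of k] by linarith
  then have "step (n + (j + i)) u = u"
    unfolding step_def using disp_near[where m = 0 and \<theta> = u and k = undefined] by (simp add: abs_le_iff minus_le_iff)
  then show ?case using Suc.IH desc_top[of n "j + i" u] by simp
qed simp

text \<open>The reference point: the phase \<open>u\<close> of a high level, carried down to level
  \<open>n\<close>. By \<open>desc_stable\<close> the high level is immaterial once it is large
  enough, and the sum of the absolute coordinates is large enough because
  \<open>int N < q N\<close>.\<close>

definition base :: "nat \<Rightarrow> int ^ 'd \<Rightarrow> int ^ 'd" where
  "base n u = desc n (nat (\<Sum>k\<in>UNIV. \<bar>u $ k\<bar>)) u"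

lemma level_bound: "\<bar>u $ k\<bar> \<le> 2000 * q (Suc (n + nat (\<Sum>k\<in>UNIV. \<bar>u $ k\<bar>)))"
proof -
  let ?N = "nat (\<Sum>k\<in>UNIV. \<bar>u $ k\<bar>)"
  have "\<bar>u $ k\<bar> \<le> (\<Sum>k\<in>UNIV. \<bar>u $ k\<bar>)" by (intro member_le_sum) auto
  also have "\<dots> \<le> int ?N" by simp
  also have "\<dots> < q ?N" by (rule q_gt)
  also have "\<dots> \<le> q (Suc (n + ?N))" by (simp add: q_mono)
  finally show ?thesis using q_pos[of "Suc (n + ?N)"] by linarith
qed

lemma base_eq:
  assumes "\<And>k. \<bar>u $ k\<bar> \<le> 2000 * q (Suc (n + j))"
  shows "base n u = desc n j u"
proof -
  let ?N = "nat (\<Sum>k\<in>UNIV. \<bar>u $ k\<bar>)"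
  have "desc n (?N + j) u = desc n ?N u" by (rule desc_stable) (rule level_bound)
  moreover have "desc n (j + ?N) u = desc n j u" using assms by (rule desc_stable)
  ultimately show ?thesis by (simp add: base_def add.commute)
qed

lemma base_step: "base n u = step n (base (Suc n) u)"
proof -
  obtain j where j: "\<And>k. \<bar>u $ k\<bar> \<le> 2000 * q (Suc (Suc n + j))" using level_bound by blast
  then have "base (Suc n) u = desc (Suc n) j u" by (rule base_eq)
  moreover have "base n u = desc n (Suc j) u" by (rule base_eq) (use j in simp)
  ultimately show ?thesis by simp
qed

lemma base_id: "(\<And>k. \<bar>u $ k\<bar> \<le> 2000 * q (Suc n)) \<Longrightarrow> base n u = u"
  using base_eq[of u n 0] by simp

section \<open>Box boundaries in a window\<close>

definition cube :: "int ^ 'd \<Rightarrow> int \<Rightarrow> (int ^ 'd) set" where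
  "cube a r = {u. \<forall>k. a $ k \<le> u $ k \<and> u $ k < a $ k + r}"

text \<open>A rectangular block of level \<open>n\<close> cubes. Here \<open>\<theta>\<close> is an
  integer lift of a phase, not a residue, so the block has a definite place.\<close>

definition cells :: "nat \<Rightarrow> int ^ 'd \<Rightarrow> int ^ 'd \<Rightarrow> int ^ 'd \<Rightarrow> bool" where
  "cells n A A' \<theta> \<longleftrightarrow> (\<forall>k. A $ k \<le> \<theta> $ k div q (Suc n) \<and> \<theta> $ k div q (Suc n) < A' $ k)"

text \<open>On the window \<open>f\<close> is a translation, except that one block of cubes is moved
  by one displacement. The block is described in the undisplaced coordinates
  \<open>u + \<tau>\<close>, and an empty block encodes a window without a tear.\<close>

definition one_tear :: "nat \<Rightarrow> (int ^ 'd \<Rightarrow> int ^ 'd) \<Rightarrow> int ^ 'd \<Rightarrow> bool" where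
  "one_tear n f a \<longleftrightarrow> (\<exists>\<tau> A A' c s. s < 3 \<and> (\<forall>u \<in> cube a (32 * q (Suc n)).
     vcong n (f u) (u + \<tau> + (if cells n A A' (u + \<tau>) then axis c (Y n s) else 0))))"

lemma not_cells_zero: "\<not> cells n 0 0 \<theta>"
  by (auto simp: cells_def dest: spec[of _ undefined])

lemma le_div_iff_int:
  fixes Q :: int
  assumes "0 < Q"
  shows "A \<le> x div Q \<longleftrightarrow> A * Q \<le> x"
proof
  assume "A \<le> x div Q"
  then have "A * Q \<le> (x div Q) * Q" using assms by (simp add: mult_right_mono)
  also have "\<dots> \<le> x" using div_mult_mod_eq[of x Q] pos_mod_sign[OF assms, of x] by linarith
  finally show "A * Q \<le> x" .
next
  assume "A * Q \<le> x"
  then have "(A * Q) div Q \<le> x div Q" using assms by (rule zdiv_mono1)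
  then show "A \<le> x div Q" using assms by simp
qed

lemma div_less_iff_int: "0 < (Q::int) \<Longrightarrow> x div Q < A \<longleftrightarrow> x < A * Q"
  using le_div_iff_int[of Q A x] by linarith

text \<open>The window has the size of a box, while boxes are well separated from each other and
  from the walls of the level \<open>n + 1\<close> cubes. Hence it meets at most one box, and a box
  is a block of level \<open>n\<close> cubes.\<close>

lemma one_tear_untorn_step:
  fixes f g :: "int ^ 'd \<Rightarrow> int ^ 'd"
  assumes f: "\<And>u. u \<in> cube a (32 * q (Suc n)) \<Longrightarrow> vcong (Suc n) (f u) (u + \<tau>)"
    and g: "\<And>u. u \<in> cube a (32 * q (Suc n)) \<Longrightarrow> vcong n (g u) (step n (f u))"
  shows "one_tear n g a"
proof -
  let ?Q = "q (Suc n)" let ?M = "q (Suc (Suc n))" let ?C = "cube a (32 * q (Suc n))"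
  have Q: "0 < ?Q" "?M = 8193 * ?Q" by (auto simp: q_pos q_Suc[of "Suc n"])
  have gu: "vcong n (g u) (u + \<tau> + disp n (u + \<tau>))" if "u \<in> ?C" for u
    using g[OF that] step_vcong[OF f[OF that]] vcong_trans unfolding step_def[of n "u + \<tau>"] by blast
  show ?thesis
  proof (cases "\<exists>u0\<in>?C. \<exists>c s. s < 3 \<and> inbox n c s (u0 + \<tau>)")
    case True
    then obtain u0 c s where u0: "u0 \<in> ?C" "s < 3" "inbox n c s (u0 + \<tau>)" by blast
    \<comment> \<open>A box keeps a distance of at least \<open>2048 * ?Q\<close> from the walls of
      its cube, so the whole window lies in the same level \<open>n + 1\<close> cube as
      \<open>u0\<close>.\<close>
    have shift: "(u + \<tau>) $ k mod ?M = (u0 + \<tau>) $ k mod ?M + (u $ k - u0 $ k) \<and>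
        (u + \<tau>) $ k div ?M = (u0 + \<tau>) $ k div ?M \<and> \<bar>u $ k - u0 $ k\<bar> < 32 * ?Q" if "u \<in> ?C" for u k
    proof -
      have d: "\<bar>u $ k - u0 $ k\<bar> < 32 * ?Q" using that u0(1) unfolding cube_def by simp (smt (verit))
      have "boxpos c s k * ?Q \<le> (u0 + \<tau>) $ k mod ?M" "(u0 + \<tau>) $ k mod ?M < (boxpos c s k + 32) * ?Q"
        using u0(3) by (auto simp: inbox_def)
      moreover have "2048 * ?Q \<le> boxpos c s k * ?Q" "(boxpos c s k + 32) * ?Q \<le> 2592 * ?Q"
        using boxpos_bounds[OF u0(2), of c k] Q(1) by (simp_all add: mult_right_mono)
      ultimately have "0 \<le> (u0 + \<tau>) $ k mod ?M + (u $ k - u0 $ k)" "(u0 + \<tau>) $ k mod ?M + (u $ k - u0 $ k) < ?M"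
        using d Q by linarith+
      moreover have "(u0 + \<tau>) $ k + (u $ k - u0 $ k) = (u + \<tau>) $ k" by simp
      ultimately have m: "(u + \<tau>) $ k mod ?M = (u0 + \<tau>) $ k mod ?M + (u $ k - u0 $ k)"
        using mod_shift by metis
      have "?M * ((u + \<tau>) $ k div ?M) = ?M * ((u0 + \<tau>) $ k div ?M)"
        using m mult_div_mod_eq[of ?M "(u + \<tau>) $ k"] mult_div_mod_eq[of ?M "(u0 + \<tau>) $ k"]
          vector_add_component[of u \<tau> k] vector_add_component[of u0 \<tau> k] by linarith
      then show ?thesis using m d Q by simp
    qed
    \<comment> \<open>A level \<open>n + 1\<close> cube has 8193 level \<open>n\<close> cells along
      each axis; \<open>A\<close> is the corner of the box counted in such cells.\<close>
    define A :: "int ^ 'd" where "A = (\<chi> k. (u0 + \<tau>) $ k div ?M * 8193 + boxpos c s k)"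
    define A' :: "int ^ 'd" where "A' = (\<chi> k. A $ k + 32)"
    have cell: "cells n A A' (u + \<tau>) \<longleftrightarrow> inbox n c s (u + \<tau>)" if "u \<in> ?C" for u
    proof -
      have "(A $ k \<le> (u + \<tau>) $ k div ?Q \<and> (u + \<tau>) $ k div ?Q < A' $ k) \<longleftrightarrow>
        (boxpos c s k * ?Q \<le> (u + \<tau>) $ k mod ?M \<and> (u + \<tau>) $ k mod ?M < (boxpos c s k + 32) * ?Q)" for k
      proof -
        have "(u + \<tau>) $ k = ((u0 + \<tau>) $ k div ?M) * ?M + (u + \<tau>) $ k mod ?M"
          using shift[OF that, of k] div_mult_mod_eq[of "(u + \<tau>) $ k" ?M] by metis
        moreover have "A $ k * ?Q = ((u0 + \<tau>) $ k div ?M) * ?M + boxpos c s k * ?Q"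
          "A' $ k * ?Q = ((u0 + \<tau>) $ k div ?M) * ?M + (boxpos c s k + 32) * ?Q"
          unfolding A_def A'_def by (simp_all add: Q(2) algebra_simps)
        ultimately show ?thesis unfolding le_div_iff_int[OF Q(1)] div_less_iff_int[OF Q(1)] by linarith
      qed
      then show ?thesis by (simp add: cells_def inbox_def)
    qed
    have d: "disp n (u + \<tau>) = (if inbox n c s (u + \<tau>) then axis c (Y n s) else 0)" if "u \<in> ?C" for u
    proof (cases "inbox n c s (u + \<tau>)")
      case True
      then show ?thesis using disp_inbox u0(2) by simp
    next
      case False
      have "\<not> inbox n e t (u + \<tau>)" if "t < 3" for e t
      proof
        assume i: "inbox n e t (u + \<tau>)"
        have near: "\<bar>boxpos c s k - boxpos e t k\<bar> < 128" for k
        proof -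
          have "boxpos c s k * ?Q \<le> (u0 + \<tau>) $ k mod ?M" "(u0 + \<tau>) $ k mod ?M < (boxpos c s k + 32) * ?Q"
            "boxpos e t k * ?Q \<le> (u + \<tau>) $ k mod ?M" "(u + \<tau>) $ k mod ?M < (boxpos e t k + 32) * ?Q"
            using u0(3) i by (auto simp: inbox_def)
          \<comment> \<open>64 is the side 32 of a box plus the side 32 of the window, still below
            the separation 128.\<close>
          then have "boxpos c s k * ?Q < (boxpos e t k + 64) * ?Q" "boxpos e t k * ?Q < (boxpos c s k + 64) * ?Q"
            using shift[OF \<open>u \<in> ?C\<close>, of k] by (auto simp: algebra_simps)
          then show ?thesis using Q(1) by (auto simp: mult_less_cancel_right)
        qed
        have "c = e \<and> s = t" by (rule boxpos_inj[OF u0(2) that near])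
        then show False using i False by simp
      qed
      from disp_notin[OF this] show ?thesis using False by simp
    qed
    show ?thesis unfolding one_tear_def using gu d cell u0(2)
      by (intro exI[of _ \<tau>] exI[of _ A] exI[of _ A'] exI[of _ c] exI[of _ s]) auto
  next
    case False
    then have "disp n (u + \<tau>) = 0" if "u \<in> ?C" for u
      by (intro disp_notin) (use that in blast)
    then show ?thesis unfolding one_tear_def using gu
      by (intro exI[of _ \<tau>] exI[of _ 0] exI[of _ 0] exI[of _ undefined] exI[of _ "0::nat"]) (auto simp: not_cells_zero)
  qed
qed

lemma cells_Suc: "cells (Suc n) A A' \<theta> \<longleftrightarrow> cells n (\<chi> k. A $ k * 8193) (\<chi> k. A' $ k * 8193) \<theta>"
proof -
  have "0 < q (Suc n)" "0 < q (Suc (Suc n))" "q (Suc (Suc n)) = 8193 * q (Suc n)"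
    by (auto simp: q_pos q_Suc[of "Suc n"])
  then show ?thesis
    unfolding cells_def by (simp add: le_div_iff_int div_less_iff_int mult.assoc)
qed

lemma axis_Y_vcong: "l < n \<Longrightarrow> vcong l (axis c (Y n s)) (axis c (V l))"
  using Y_cong[of l n s] by (simp add: vcong_def axis_def)

text \<open>If the tear of level \<open>n + 1\<close> does not cut the smaller window, the points
  there move by one translation and only a box of step \<open>n\<close> can tear them. If it does
  cut, it does so along a wall of the level \<open>n + 1\<close> grid, and near a wall there are no
  boxes of step \<open>n\<close>.\<close>

lemma one_tear_step:
  fixes f g :: "int ^ 'd \<Rightarrow> int ^ 'd"
  assumes f: "one_tear (Suc n) f a"
    and g: "\<And>u. u \<in> cube a (32 * q (Suc n)) \<Longrightarrow> vcong n (g u) (step n (f u))"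
  shows "one_tear n g a"
proof -
  let ?Q = "q (Suc n)" let ?M = "q (Suc (Suc n))" let ?C = "cube a (32 * q (Suc n))"
  have Q: "0 < ?Q" "?M = 8193 * ?Q" by (auto simp: q_pos q_Suc[of "Suc n"])
  obtain \<tau> A A' c s where s: "s < 3" and f0: "\<And>u. u \<in> cube a (32 * ?M) \<Longrightarrow>
     vcong (Suc n) (f u) (u + \<tau> + (if cells (Suc n) A A' (u + \<tau>) then axis c (Y (Suc n) s) else 0))"
    using f unfolding one_tear_def by blast
  have "?C \<subseteq> cube a (32 * ?M)"
  proof
    fix u assume "u \<in> ?C"
    moreover have "?Q \<le> ?M" using Q by simp
    ultimately show "u \<in> cube a (32 * ?M)" unfolding cube_def by (smt (verit) mem_Collect_eq)
  qed
  then have f1: "vcong (Suc n) (f u) (u + \<tau> + (if cells (Suc n) A A' (u + \<tau>) then axis c (Y (Suc n) s) else 0))"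
    if "u \<in> ?C" for u using f0 that by blast
  consider "\<forall>u\<in>?C. cells (Suc n) A A' (u + \<tau>)" | "\<forall>u\<in>?C. \<not> cells (Suc n) A A' (u + \<tau>)"
    | u1 u2 where "u1 \<in> ?C" "cells (Suc n) A A' (u1 + \<tau>)" "u2 \<in> ?C" "\<not> cells (Suc n) A A' (u2 + \<tau>)"
    by blast
  then show ?thesis
  proof cases
    case 1
    show ?thesis
      by (rule one_tear_untorn_step[of a n f "\<tau> + axis c (Y (Suc n) s)"])
         (use f1 1 g in \<open>auto simp: add.assoc\<close>)
  next
    case 2
    show ?thesis
      by (rule one_tear_untorn_step[of a n f \<tau>]) (use f1 2 g in auto)
  next
    case 3
    obtain k where k1: "A $ k \<le> (u1 + \<tau>) $ k div ?M" "(u1 + \<tau>) $ k div ?M < A' $ k"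
      and k2: "\<not> (A $ k \<le> (u2 + \<tau>) $ k div ?M \<and> (u2 + \<tau>) $ k div ?M < A' $ k)"
      using 3 unfolding cells_def by blast
    \<comment> \<open>Passing from inside to outside the block along axis \<open>k\<close> crosses a
      wall, which sits at a multiple of \<open>?M\<close>.\<close>
    have "\<exists>m. ((u1 + \<tau>) $ k < m * ?M \<and> m * ?M \<le> (u2 + \<tau>) $ k) \<or> ((u2 + \<tau>) $ k < m * ?M \<and> m * ?M \<le> (u1 + \<tau>) $ k)"
      using k1 k2 le_div_iff_int[of ?M] div_less_iff_int[of ?M] q_pos[of "Suc (Suc n)"]
      by (metis linorder_not_le)
    then obtain m where m: "((u1 + \<tau>) $ k < m * ?M \<and> m * ?M \<le> (u2 + \<tau>) $ k) \<or> ((u2 + \<tau>) $ k < m * ?M \<and> m * ?M \<le> (u1 + \<tau>) $ k)"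
      by blast
    have near: "\<bar>(u + \<tau>) $ k - ?M * m\<bar> \<le> 32 * ?Q" if "u \<in> ?C" for u
    proof -
      have "a $ k \<le> u $ k" "u $ k < a $ k + 32 * ?Q" "a $ k \<le> u1 $ k" "u1 $ k < a $ k + 32 * ?Q"
           "a $ k \<le> u2 $ k" "u2 $ k < a $ k + 32 * ?Q"
        using that 3 by (auto simp: cube_def)
      then show ?thesis using m by (simp add: mult.commute) linarith
    qed
    \<comment> \<open>The window contributes at most 32 and the displacement at most 41 units of
      \<open>?Q\<close>, far below the 2000 allowed by \<open>disp_near\<close>.\<close>
    have nodisp: "disp n (u + \<tau> + (if b then axis c (Y (Suc n) s) else 0)) = 0" if "u \<in> ?C" for u b
    proof (rule disp_near[where k = k and m = m])
      have "0 \<le> (if b then axis c (Y (Suc n) s) else 0) $ k \<and> (if b then axis c (Y (Suc n) s) else 0) $ k \<le> 41 * ?Q"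
        using Y_bounds[OF s, of "Suc n"] Q by (auto simp: axis_def)
      then show "- (2000 * ?Q) \<le> (u + \<tau> + (if b then axis c (Y (Suc n) s) else 0)) $ k - ?M * m"
        "(u + \<tau> + (if b then axis c (Y (Suc n) s) else 0)) $ k - ?M * m \<le> 2000 * ?Q"
        using near[OF that] Q unfolding vector_add_component[of "u + \<tau>"] by linarith+
    qed
    \<comment> \<open>Modulo \<open>q (Suc n)\<close> the displacement \<open>Y (Suc n) s\<close> is
      \<open>V n = Y n 0\<close>, so the surviving tear has the required form with index 0.\<close>
    have "vcong n (g u) (u + \<tau> + (if cells (Suc n) A A' (u + \<tau>) then axis c (Y n 0) else 0))" if "u \<in> ?C" for u
    proof -
      have "vcong n (step n (f u)) (u + \<tau> + (if cells (Suc n) A A' (u + \<tau>) then axis c (Y (Suc n) s) else 0))"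
        using step_vcong[OF f1[OF that]] unfolding step_def nodisp[OF that] by simp
      moreover have "vcong n (u + \<tau> + (if cells (Suc n) A A' (u + \<tau>) then axis c (Y (Suc n) s) else 0))
         (u + \<tau> + (if cells (Suc n) A A' (u + \<tau>) then axis c (Y n 0) else 0))"
        by (rule vcong_add) (use axis_Y_vcong[of n "Suc n" c s] in \<open>auto simp: Y_def[of n 0]\<close>)
      ultimately show ?thesis using g[OF that] vcong_trans by blast
    qed
    then show ?thesis unfolding one_tear_def cells_Suc
      by (intro exI[of _ \<tau>] exI[of _ "\<chi> k. A $ k * 8193"] exI[of _ "\<chi> k. A' $ k * 8193"] exI[of _ c] exI[of _ "0::nat"]) auto
  qed
qed

lemma desc_one_tear: "one_tear n (desc n j) a"
proof (induction j arbitrary: n)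
  case 0
  show ?case unfolding one_tear_def
    by (intro exI[of _ 0] exI[of _ undefined] exI[of _ "0::nat"]) (simp add: not_cells_zero)
next
  case (Suc j)
  show ?case by (rule one_tear_step[OF Suc.IH]) simp
qed

lemma finite_box: "finite {u :: int ^ 'd. \<forall>k. \<bar>u $ k\<bar> \<le> R}"
proof (rule inj_on_finite)
  show "inj_on vec_nth {u :: int ^ 'd. \<forall>k. \<bar>u $ k\<bar> \<le> R}" by (auto simp: inj_on_def vec_eq_iff)
  show "vec_nth ` {u :: int ^ 'd. \<forall>k. \<bar>u $ k\<bar> \<le> R} \<subseteq> Pi\<^sub>E UNIV (\<lambda>_. {-R..R})"
    by (auto simp: PiE_def abs_le_iff) (metis minus_le_iff)
  show "finite (Pi\<^sub>E UNIV (\<lambda>_ :: 'd. {-R..R}))" by (rule finite_PiE) auto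
qed

lemma bounded_cube: "\<exists>R. \<forall>u\<in>cube a r. \<forall>k. \<bar>u $ k\<bar> \<le> R"
proof -
  have "\<bar>u $ k\<bar> \<le> (\<Sum>k\<in>UNIV. \<bar>a $ k\<bar>) + \<bar>r\<bar>" if "u \<in> cube a r" for u k
  proof -
    have "\<bar>a $ k\<bar> \<le> (\<Sum>k\<in>UNIV. \<bar>a $ k\<bar>)" by (intro member_le_sum) auto
    moreover have "a $ k \<le> u $ k" "u $ k < a $ k + r" using that by (auto simp: cube_def)
    ultimately show ?thesis by linarith
  qed
  then show ?thesis by blast
qed

lemma ex_bound_finite:
  assumes "finite S" shows "\<exists>R. \<forall>u\<in>S. \<forall>k. \<bar>(u :: int ^ 'd) $ k\<bar> \<le> R"
proof -
  have "\<bar>u $ k\<bar> \<le> (\<Sum>u\<in>S. \<Sum>k\<in>UNIV. \<bar>u $ k\<bar>)" if "u \<in> S" for u k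
  proof -
    have "\<bar>u $ k\<bar> \<le> (\<Sum>k\<in>UNIV. \<bar>u $ k\<bar>)" by (intro member_le_sum) auto
    also have "\<dots> \<le> (\<Sum>u\<in>S. \<Sum>k\<in>UNIV. \<bar>u $ k\<bar>)" using that assms
      by (intro member_le_sum[of u S "\<lambda>u. \<Sum>k\<in>UNIV. \<bar>u $ k\<bar>"]) (auto intro: sum_nonneg)
    finally show ?thesis .
  qed
  then show ?thesis by blast
qed

lemma base_one_tear: "one_tear n (base n) a"
proof -
  obtain R where R: "\<And>u k. u \<in> cube a (32 * q (Suc n)) \<Longrightarrow> \<bar>u $ k\<bar> \<le> R" using bounded_cube by blast
  have "base n u = desc n (nat R) u" if "u \<in> cube a (32 * q (Suc n))" for u
  proof (rule base_eq)
    fix k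
    have "\<bar>u $ k\<bar> \<le> int (nat R)" using R[OF that, of k] by linarith
    also have "\<dots> < q (nat R)" by (rule q_gt)
    also have "\<dots> \<le> q (Suc (n + nat R))" by (rule q_mono) simp
    finally show "\<bar>u $ k\<bar> \<le> 2000 * q (Suc (n + nat R))" using q_pos[of "Suc (n + nat R)"] by linarith
  qed
  then show ?thesis using desc_one_tear[of n "nat R" a] unfolding one_tear_def by (metis (no_types, lifting))
qed

section \<open>Translates of the base point and their limits\<close>

lemma one_tear_shift: "one_tear n f a \<Longrightarrow> one_tear n (\<lambda>u. f (u + t)) (a - t)"
proof -
  assume "one_tear n f a"
  then obtain \<tau> A A' c s where s: "s < 3" and f0: "\<And>u. u \<in> cube a (32 * q (Suc n)) \<Longrightarrow>
     vcong n (f u) (u + \<tau> + (if cells n A A' (u + \<tau>) then axis c (Y n s) else 0))"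
    unfolding one_tear_def by blast
  have "vcong n (f (u + t)) (u + (t + \<tau>) + (if cells n A A' (u + (t + \<tau>)) then axis c (Y n s) else 0))"
    if "u \<in> cube (a - t) (32 * q (Suc n))" for u
  proof -
    have "u + t \<in> cube a (32 * q (Suc n))" using that by (simp add: cube_def) (smt (verit))
    from f0[OF this] show ?thesis by (simp add: add.assoc)
  qed
  then show ?thesis unfolding one_tear_def using s by blast
qed

text \<open>Membership in the orbit closure of \<open>base\<close>, expressed by finite windows and
  finitely many levels. Values count only up to \<open>vcong\<close>; no representative of a residue
  is fixed.\<close>

definition phases :: "(nat \<Rightarrow> int ^ 'd \<Rightarrow> int ^ 'd) \<Rightarrow> bool" where
  "phases p \<longleftrightarrow> (\<forall>N R. \<exists>t. \<forall>n\<le>N. \<forall>u. (\<forall>k. \<bar>u $ k\<bar> \<le> R) \<longrightarrow> vcong n (p n u) (base n (u + t)))"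

lemma phasesE:
  assumes "phases p"
  obtains t where "\<And>n u. n \<le> N \<Longrightarrow> (\<And>k. \<bar>u $ k\<bar> \<le> R) \<Longrightarrow> vcong n (p n u) (base n (u + t))"
  using assms[unfolded phases_def, THEN spec, of N, THEN spec, of R] by auto

lemma phases_step: assumes "phases p" shows "vcong n (p n u) (step n (p (Suc n) u))"
proof -
  obtain R where R: "\<And>k. \<bar>u $ k\<bar> \<le> R" using ex_bound_finite[of "{u}"] by auto
  obtain t where t: "\<And>m u. m \<le> Suc n \<Longrightarrow> (\<And>k. \<bar>u $ k\<bar> \<le> R) \<Longrightarrow> vcong m (p m u) (base m (u + t))"
    using phasesE[OF assms] by blast
  have "vcong n (p n u) (base n (u + t))" "vcong (Suc n) (p (Suc n) u) (base (Suc n) (u + t))"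
    using t[of n u] t[of "Suc n" u] R by auto
  then show ?thesis using base_step step_vcong vcong_sym vcong_trans by metis
qed

lemma phases_one_tear: assumes "phases p" shows "one_tear n (p n) a"
proof -
  obtain R where R: "\<And>u k. u \<in> cube a (32 * q (Suc n)) \<Longrightarrow> \<bar>u $ k\<bar> \<le> R" using bounded_cube by blast
  obtain t where t: "\<And>m u. m \<le> n \<Longrightarrow> (\<And>k. \<bar>u $ k\<bar> \<le> R) \<Longrightarrow> vcong m (p m u) (base m (u + t))"
    using phasesE[OF assms] by blast
  have "one_tear n (\<lambda>u. base n (u + t)) a"
    using one_tear_shift[OF base_one_tear[of n "a + t"], of t] by simp
  then obtain \<tau> A A' c s where s: "s < 3" and f0: "\<And>u. u \<in> cube a (32 * q (Suc n)) \<Longrightarrow>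
     vcong n (base n (u + t)) (u + \<tau> + (if cells n A A' (u + \<tau>) then axis c (Y n s) else 0))"
    unfolding one_tear_def by blast
  have "vcong n (p n u) (u + \<tau> + (if cells n A A' (u + \<tau>) then axis c (Y n s) else 0))"
    if "u \<in> cube a (32 * q (Suc n))" for u
    by (rule vcong_trans[OF t f0]) (use R that in auto)
  then show ?thesis unfolding one_tear_def using s by blast
qed

lemma phases_base: "phases base"
  unfolding phases_def by (metis add.right_neutral vcong_refl)

lemma phases_shift: assumes "phases p" shows "phases (\<lambda>n u. p n (u + g))"
  unfolding phases_def
proof (intro allI)
  fix N R
  obtain G where G: "\<And>k. \<bar>g $ k\<bar> \<le> G" using ex_bound_finite[of "{g}"] by auto
  obtain t where t: "\<And>n u. n \<le> N \<Longrightarrow> (\<And>k. \<bar>u $ k\<bar> \<le> R + G) \<Longrightarrow> vcong n (p n u) (base n (u + t))"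
    using phasesE[OF assms] by blast
  have "vcong n (p n (u + g)) (base n (u + (g + t)))" if "n \<le> N" "\<forall>k. \<bar>u $ k\<bar> \<le> R" for n u
  proof -
    have "\<bar>(u + g) $ k\<bar> \<le> R + G" for k using that(2) G[of k] by (simp add: abs_le_iff) (smt (verit))
    then show ?thesis using t[OF that(1), of "u + g"] by (simp add: add.assoc)
  qed
  then show "\<exists>t. \<forall>n\<le>N. \<forall>u. (\<forall>k. \<bar>u $ k\<bar> \<le> R) \<longrightarrow> vcong n (p n (u + g)) (base n (u + t))" by blast
qed

text \<open>The phase of a level determines those of all lower levels through
  \<open>step\<close>.\<close>

lemma phases_level:
  assumes "phases p" "phases r" "vcong l (p l u) (r l w)" "n \<le> l"
  shows "vcong n (p n u) (r n w)"
  using assms(4)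
proof (induction rule: inc_induct)
  case (step m)
  then show ?case
    using phases_step[OF assms(1), of m u] phases_step[OF assms(2), of m w] step_vcong vcong_sym vcong_trans by metis
qed (use assms(3) in simp)

section \<open>Offsets of a pair of points\<close>

text \<open>\<open>\<sigma>\<close> is the offset of the second point against the first in a region
  where both are untorn; the factor 2 leaves room for a complete cell of the first point's
  grid.\<close>

definition wide :: "(nat \<Rightarrow> int ^ 'd \<Rightarrow> int ^ 'd) \<Rightarrow> (nat \<Rightarrow> int ^ 'd \<Rightarrow> int ^ 'd) \<Rightarrow> nat \<Rightarrow> int ^ 'd \<Rightarrow> bool" where
  "wide p1 p2 n \<sigma> \<longleftrightarrow> (\<exists>a \<tau>. \<forall>u \<in> cube a (2 * q (Suc n)).
     vcong n (p1 n u) (u + \<tau>) \<and> vcong n (p2 n u) (u + \<tau> + \<sigma>))"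

text \<open>Roughly the second quarter, in each coordinate, of the level \<open>n\<close> cube with
  corner \<open>g\<close>. For \<open>n = Suc m\<close> it contains the boxes of step
  \<open>m\<close> in this cube as well as the free space beyond them.\<close>

definition window :: "nat \<Rightarrow> int ^ 'd \<Rightarrow> (int ^ 'd) set" where
  "window n g = {u. \<forall>k. 2048 * q n \<le> u $ k - g $ k \<and> u $ k - g $ k < 4096 * q n}"

definition narrow :: "(nat \<Rightarrow> int ^ 'd \<Rightarrow> int ^ 'd) \<Rightarrow> (nat \<Rightarrow> int ^ 'd \<Rightarrow> int ^ 'd) \<Rightarrow> nat \<Rightarrow> int ^ 'd \<Rightarrow> bool" where
  "narrow p1 p2 n \<sigma> \<longleftrightarrow> (\<exists>g. \<forall>u \<in> window n g.
     vcong n (p1 n u) (u - g) \<and> vcong n (p2 n u) (u - g + \<sigma>))"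

text \<open>
  The bound \<open>7 / 8\<close> is such that an offset above it leaves a part of each box uncovered that contains a
  \<open>window\<close> of the next lower level.
\<close>

definition near0 :: "nat \<Rightarrow> int ^ 'd \<Rightarrow> bool" where
  "near0 n \<rho> \<longleftrightarrow> (\<forall>k. \<exists>j. 8 * \<bar>\<rho> $ k - j * q (Suc n)\<bar> < 7 * q n)"

text \<open>A cube of side \<open>2 * q (Suc n)\<close> contains a complete cell of the first
  point's grid, and \<open>g\<close> is the corner of that cell.\<close>

lemma wide_narrow:
  assumes "wide p1 p2 n \<sigma>" shows "narrow p1 p2 n \<sigma>"
proof -
  obtain a \<tau> where w: "\<And>u. u \<in> cube a (2 * q (Suc n)) \<Longrightarrow>
     vcong n (p1 n u) (u + \<tau>) \<and> vcong n (p2 n u) (u + \<tau> + \<sigma>)"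
    using assms unfolding wide_def by blast
  define g where "g = (\<chi> k. a $ k + (- \<tau> $ k - a $ k) mod q (Suc n))"
  have g: "a $ k \<le> g $ k \<and> g $ k < a $ k + q (Suc n)" for k
    using q_pos[of "Suc n"] by (simp add: g_def)
  have "vcong n \<tau> (- g)"
  proof -
    have "[\<tau> $ k = - (a $ k + (- \<tau> $ k - a $ k) mod q (Suc n))] (mod q (Suc n))" for k
      unfolding cong_iff_dvd_diff
      by (simp add: minus_div_mult_eq_mod[symmetric])
    then show ?thesis by (simp add: vcong_def g_def)
  qed
  then have t: "vcong n (u + \<tau>) (u - g)" for u
    using vcong_add[OF vcong_refl, of n \<tau> "- g" u] by simp
  have "vcong n (p1 n u) (u - g) \<and> vcong n (p2 n u) (u - g + \<sigma>)" if "u \<in> window n g" for u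
  proof -
    have "u \<in> cube a (2 * q (Suc n))"
    proof -
      have "a $ k \<le> u $ k \<and> u $ k < a $ k + 2 * q (Suc n)" for k
      proof -
        have "2048 * q n \<le> u $ k - g $ k" "u $ k - g $ k < 4096 * q n" using that by (auto simp: window_def)
        then show ?thesis using g[of k] q_pos[of n] unfolding q_Suc by linarith
      qed
      then show ?thesis by (simp add: cube_def)
    qed
    then show ?thesis using w t vcong_add[OF t, of \<sigma> \<sigma>] vcong_trans vcong_refl by blast
  qed
  then show ?thesis unfolding narrow_def by blast
qed

lemma wide_vcong:
  assumes "wide p1 p2 n \<sigma>" "vcong n \<sigma> \<sigma>'"
  shows "wide p1 p2 n \<sigma>'"
  using assms vcong_add[OF vcong_refl assms(2)] vcong_trans unfolding wide_def by blast

lemma phases_stepD: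
  "phases p \<Longrightarrow> vcong (Suc n) (p (Suc n) u) \<theta> \<Longrightarrow> vcong n (p n u) (step n \<theta>)"
  using phases_step step_vcong vcong_trans by blast

text \<open>The window contains a cube of side \<open>2 * q (Suc n)\<close> in which neither point
  lies in a box; there both phases descend without displacement and the offset persists.\<close>

lemma narrow_wide:
  fixes p1 p2 :: "nat \<Rightarrow> int ^ 'd \<Rightarrow> int ^ 'd"
  assumes p: "phases p1" "phases p2" and "narrow p1 p2 (Suc n) \<rho>"
  shows "wide p1 p2 n \<rho>"
proof -
  obtain g where g: "\<And>u. u \<in> window (Suc n) g \<Longrightarrow>
     vcong (Suc n) (p1 (Suc n) u) (u - g) \<and> vcong (Suc n) (p2 (Suc n) u) (u - g + \<rho>)"
    using assms unfolding narrow_def by blast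
  let ?Q = "q (Suc n)" let ?M = "q (Suc (Suc n))"
  have Q: "0 < ?Q" "?M = 8193 * ?Q" by (auto simp: q_pos q_Suc[of "Suc n"])
  define k0 :: 'd where "k0 = undefined"
  define d where "d = \<rho> $ k0 mod ?M"
  have d: "0 \<le> d" "d < ?M" using q_pos[of "Suc (Suc n)"] by (simp_all add: d_def)
  \<comment> \<open>The first point is safe beyond 2592. For the second, shifted by
    \<open>d\<close>, the start 2600 hits the band from 2048 to 2592 after wrapping around only if
    \<open>d\<close> lies between 7639 = 8193 + 2048 - 2602 and 8185 = 8193 + 2592 - 2600; then 3600
    avoids the band.\<close>
  define e :: int where "e = (if 7639 * ?Q < d \<and> d < 8185 * ?Q then 3600 else 2600)"
  have e: "2600 \<le> e" "e \<le> 3600" by (auto simp: e_def)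
  define a where "a = (\<chi> k. g $ k + e * ?Q)"
  have "vcong n (p1 n u) (u - g) \<and> vcong n (p2 n u) (u - g + \<rho>)" if u: "u \<in> cube a (2 * ?Q)" for u
  proof -
    have b: "e * ?Q \<le> u $ k - g $ k \<and> u $ k - g $ k < e * ?Q + 2 * ?Q" for k
      using u by (auto simp: cube_def a_def algebra_simps)
    have "2600 * ?Q \<le> e * ?Q" "e * ?Q \<le> 3600 * ?Q" using e Q by (simp_all add: mult_right_mono)
    then have b': "2600 * ?Q \<le> u $ k - g $ k \<and> u $ k - g $ k < 3602 * ?Q" for k using b[of k] by linarith
    have "u \<in> window (Suc n) g" using b' Q unfolding window_def by (smt (verit) mem_Collect_eq)
    note gu = g[OF this]
    have "disp n (u - g) = 0"
    proof (rule disp_notin, rule not_inbox_coord)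
      show "(u - g) $ k0 mod ?M < 2048 * ?Q \<or> 2592 * ?Q \<le> (u - g) $ k0 mod ?M"
        using b'[of k0] Q by (simp add: mod_pos_pos_trivial)
    qed
    moreover have "disp n (u - g + \<rho>) = 0"
    proof (rule disp_notin, rule not_inbox_coord)
      define x where "x = u $ k0 - g $ k0"
      have x: "e * ?Q \<le> x" "x < e * ?Q + 2 * ?Q" using b[of k0] by (auto simp: x_def)
      have "(u - g + \<rho>) $ k0 mod ?M = (x + d) mod ?M" by (simp add: x_def d_def mod_add_right_eq)
      moreover have "(x + d) mod ?M < 2048 * ?Q \<or> 2592 * ?Q \<le> (x + d) mod ?M"
      proof (cases "x + d < ?M")
        case True
        then have "(x + d) mod ?M = x + d" using d b'[of k0] Q by (intro mod_pos_pos_trivial) (auto simp: x_def)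
        then show ?thesis using b'[of k0] d Q by (auto simp: x_def)
      next
        case False
        have "(x + d) mod ?M = (x + d - ?M) mod ?M" by simp
        also have "\<dots> = x + d - ?M" using False d b'[of k0] Q by (intro mod_pos_pos_trivial) (auto simp: x_def)
        finally have *: "(x + d) mod ?M = x + d - ?M" .
        show ?thesis
        proof (cases "7639 * ?Q < d \<and> d < 8185 * ?Q")
          case True
          then have "3600 * ?Q \<le> x" using x by (simp add: e_def)
          then show ?thesis unfolding * using True Q by linarith
        next
          case f: False
          then have "e = 2600" unfolding e_def by simp
          then have xx: "2600 * ?Q \<le> x" "x < 2602 * ?Q" using x by simp_all
          from f have "d \<le> 7639 * ?Q \<or> 8185 * ?Q \<le> d" by linarith
          then show ?thesis unfolding * using xx Q by (elim disjE) linarith+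
        qed
      qed
      ultimately show "(u - g + \<rho>) $ k0 mod ?M < 2048 * ?Q \<or> 2592 * ?Q \<le> (u - g + \<rho>) $ k0 mod ?M" by simp
    qed
    ultimately show ?thesis
      using phases_stepD[OF p(1) conjunct1[OF gu]] phases_stepD[OF p(2) conjunct2[OF gu]] by (simp add: step_def)
  qed
  then show ?thesis unfolding wide_def by (intro exI[of _ a] exI[of _ "- g"]) simp
qed

definition region :: "nat \<Rightarrow> int ^ 'd \<Rightarrow> 'd \<Rightarrow> nat \<Rightarrow> (int ^ 'd) set" where
  "region n g c s = {u. \<forall>k. boxpos c s k * q (Suc n) \<le> u $ k - g $ k \<and> u $ k - g $ k < (boxpos c s k + 32) * q (Suc n)}"

text \<open>As \<open>\<rho>\<close> is not nearly zero, the second point's copy of the box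
  \<open>(c, s)\<close> leaves one end of the first point's box free along some axis
  \<open>k0\<close>. At that end only the first point is displaced, so the offset drops by
  \<open>Y n s\<close> along \<open>c\<close>.\<close>

lemma see_unblocked:
  fixes p1 p2 :: "nat \<Rightarrow> int ^ 'd \<Rightarrow> int ^ 'd"
  assumes p: "phases p1" "phases p2"
    and g: "\<And>u. u \<in> window (Suc n) g \<Longrightarrow>
       vcong (Suc n) (p1 (Suc n) u) (u - g) \<and> vcong (Suc n) (p2 (Suc n) u) (u - g + \<rho>)"
    and "\<not> near0 (Suc n) \<rho>" and s: "s < 3"
    and unb: "\<And>u e t. u \<in> region n g c s \<Longrightarrow> t < 3 \<Longrightarrow> inbox n e t (u - g + \<rho>) \<Longrightarrow> e = c \<and> t = s"
  shows "narrow p1 p2 n (\<rho> - axis c (Y n s))"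
proof -
  let ?Q = "q (Suc n)" let ?M = "q (Suc (Suc n))"
  have Q: "0 < q n" "?Q = 8193 * q n" "?M = 8193 * ?Q" by (auto simp: q_pos q_Suc)
  obtain k0 where k0: "\<And>j. 7 * ?Q \<le> 8 * \<bar>\<rho> $ k0 - j * ?M\<bar>"
    using assms(4) unfolding near0_def by (meson linorder_not_less)
  define d where "d = \<rho> $ k0 mod ?M"
  have d0: "0 \<le> d" "d < ?M" using q_pos[of "Suc (Suc n)"] by (simp_all add: d_def)
  have de: "d = \<rho> $ k0 - (\<rho> $ k0 div ?M) * ?M" unfolding d_def by (simp add: minus_div_mult_eq_mod)
  have "\<rho> $ k0 - (\<rho> $ k0 div ?M + 1) * ?M = d - ?M" unfolding de by (simp add: algebra_simps)
  then have d: "7 * ?Q \<le> 8 * d" "7 * ?Q \<le> 8 * (?M - d)"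
    using k0[of "\<rho> $ k0 div ?M"] k0[of "\<rho> $ k0 div ?M + 1"] d0 unfolding de[symmetric] by simp_all
  \<comment> \<open>The free end is the last of the 32 layers if moving on by \<open>d\<close>
    leaves the box above, and the first layer if moving back by \<open>?M - d\<close> leaves it
    below.\<close>
  define e :: int where "e = (if d \<le> ?M - 32 * ?Q then 31 else 0)"
  \<comment> \<open>Subtracting the displacement makes \<open>g'\<close> the corner of the chosen
    cell as the displaced first point sees it.\<close>
  define g' where "g' = (\<chi> k. g $ k + boxpos c s k * ?Q + (if k = k0 then e * ?Q else 0) - axis c (Y n s) $ k)"
  have Yb: "0 \<le> axis c (Y n s) $ k \<and> axis c (Y n s) $ k \<le> 41 * q n" for k
    using Y_bounds[OF s, of n] Q by (auto simp: axis_def)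
  have "vcong n (p1 n u) (u - g') \<and> vcong n (p2 n u) (u - g' + (\<rho> - axis c (Y n s)))" if u: "u \<in> window n g'" for u
  proof -
    define z where "z k = u $ k - g $ k - boxpos c s k * ?Q" for k
    have "2048 * q n \<le> u $ k - g' $ k \<and> u $ k - g' $ k < 4096 * q n" for k using u by (auto simp: window_def)
    moreover have "u $ k - g' $ k = z k - (if k = k0 then e * ?Q else 0) + axis c (Y n s) $ k" for k
      by (simp add: g'_def z_def)
    \<comment> \<open>2007 = 2048 - 41 allows for a displacement of up to
      \<open>41 * q n\<close>.\<close>
    ultimately have z: "2007 * q n \<le> z k - (if k = k0 then e * ?Q else 0)"
      "z k - (if k = k0 then e * ?Q else 0) < 4096 * q n" for k using Yb[of k] by (smt (verit))+
    have "0 \<le> e * ?Q" "e * ?Q \<le> 31 * ?Q" using Q by (auto simp: e_def)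
    then have z': "0 \<le> z k \<and> z k < 32 * ?Q" for k using z[of k] Q
      by (cases "k = k0") (simp_all only: if_True if_False simp_thms, linarith+)
    then have reg: "u \<in> region n g c s" by (auto simp: region_def z_def algebra_simps)
    have P: "2048 * ?Q \<le> boxpos c s k * ?Q" "boxpos c s k * ?Q \<le> 2560 * ?Q" for k
      using boxpos_bounds[OF s, of c k] Q by (simp_all add: mult_right_mono)
    have w: "2048 * ?Q \<le> u $ k - g $ k \<and> u $ k - g $ k < 2592 * ?Q" for k
      using z'[of k] P[of k] unfolding z_def by linarith
    have "u \<in> window (Suc n) g"
      using w Q unfolding window_def by (smt (verit) mem_Collect_eq)
    note gu = g[OF this]
    have "inbox n c s (u - g)"
    proof -
      have "(u - g) $ k mod ?M = u $ k - g $ k" for k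
        using w[of k] Q by (simp add: mod_pos_pos_trivial)
      then show ?thesis using reg by (simp add: inbox_def region_def)
    qed
    then have d1: "disp n (u - g) = axis c (Y n s)" using disp_inbox s by blast
    have d2: "disp n (u - g + \<rho>) = 0"
    proof (rule disp_notin, rule notI)
      fix e' t assume t: "t < 3" "inbox n e' t (u - g + \<rho>)"
      then have "inbox n c s (u - g + \<rho>)" using unb[OF reg t] by simp
      then have i: "boxpos c s k0 * ?Q \<le> (u - g + \<rho>) $ k0 mod ?M" "(u - g + \<rho>) $ k0 mod ?M < (boxpos c s k0 + 32) * ?Q"
        by (auto simp: inbox_def)
      define X where "X = boxpos c s k0 * ?Q + z k0"
      have "(u - g + \<rho>) $ k0 mod ?M = (X + d) mod ?M"
        by (simp add: X_def z_def d_def mod_add_right_eq)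
      note i' = i[unfolded this]
      show False
      proof (cases "d \<le> ?M - 32 * ?Q")
        case True
        then have "31 * ?Q + 2007 * q n \<le> z k0" using z(1)[of k0] by (simp add: e_def)
        \<comment> \<open>Here the bound \<open>7 / 8\<close> enters: seven eighths of
          \<open>?Q\<close> together with \<open>2007 * q n\<close> exceed
          \<open>?Q\<close>.\<close>
        then have b: "32 * ?Q < z k0 + d" "z k0 + d < ?M" using True d z'[of k0] Q by linarith+
        show False
        proof (cases "X + d < ?M")
          case True
          then have "(X + d) mod ?M = X + d"
            using d0 P[of k0] z'[of k0] Q unfolding X_def by (intro mod_pos_pos_trivial) linarith+
          then show False using i' b by (simp add: X_def algebra_simps)
        next
          case False
          have "(X + d) mod ?M = (X + d - ?M) mod ?M" by simp
          also have "\<dots> = X + d - ?M"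
            using False b P[of k0] Q unfolding X_def by (intro mod_pos_pos_trivial) linarith+
          finally show False using i' b by (simp add: X_def algebra_simps)
        qed
      next
        case False
        then have "z k0 < 4096 * q n" using z(2)[of k0] by (simp add: e_def)
        moreover have "?Q < 2 * (?M - d)" using d(2) Q by linarith
        ultimately have "2 * z k0 < 2 * (?M - d)" using Q by linarith
        then have b: "z k0 + d < ?M" by simp
        have "(X + d) mod ?M = (X + d - ?M) mod ?M" by simp
        also have "\<dots> = X + d - ?M"
          using False b P[of k0] z'[of k0] Q unfolding X_def by (intro mod_pos_pos_trivial) linarith+
        finally show False using i' b by (simp add: X_def algebra_simps)
      qed
    qed
    have v: "vcong n (u - g + axis c (Y n s)) (u - g')"
      unfolding vcong_def cong_iff_dvd_diff by (simp add: g'_def)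
    have "vcong n (p1 n u) (u - g + axis c (Y n s))"
      using phases_stepD[OF p(1) conjunct1[OF gu]] d1 by (simp add: step_def)
    moreover have "vcong n (p2 n u) (u - g + \<rho>)"
      using phases_stepD[OF p(2) conjunct2[OF gu]] d2 by (simp add: step_def)
    moreover have "vcong n (u - g + \<rho>) (u - g' + (\<rho> - axis c (Y n s)))"
      using vcong_add[OF v vcong_refl, of "\<rho> - axis c (Y n s)"] by (simp add: algebra_simps)
    ultimately show ?thesis using v vcong_trans by blast
  qed
  then show ?thesis unfolding narrow_def by blast
qed

section \<open>Boxes blocked by boxes of other indices\<close>

lemma blocked_offset:
  assumes "u \<in> region n g c s" "inbox n e t (u - g + \<rho>)"
  shows "\<exists>j. \<bar>\<rho> $ k - (boxpos e t k - boxpos c s k) * q (Suc n) - j * q (Suc (Suc n))\<bar> < 32 * q (Suc n)"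
proof -
  have "boxpos c s k * q (Suc n) \<le> u $ k - g $ k" "u $ k - g $ k < (boxpos c s k + 32) * q (Suc n)"
    "boxpos e t k * q (Suc n) \<le> (u - g + \<rho>) $ k mod q (Suc (Suc n))"
    "(u - g + \<rho>) $ k mod q (Suc (Suc n)) < (boxpos e t k + 32) * q (Suc n)"
    using assms by (auto simp: region_def inbox_def)
  moreover have "(u - g + \<rho>) $ k mod q (Suc (Suc n)) =
      u $ k - g $ k + \<rho> $ k - (u - g + \<rho>) $ k div q (Suc (Suc n)) * q (Suc (Suc n))"
    by (simp add: minus_div_mult_eq_mod)
  ultimately show ?thesis
    by (intro exI[of _ "(u - g + \<rho>) $ k div q (Suc (Suc n))"]) (simp add: left_diff_distrib distrib_right)
qed

text \<open>Two blockings make two differences of box positions nearly congruent, hence equal.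
  Comparing coordinates gives \<open>e1 = e2 = c\<close>, and then
  \<open>2 ^ s1 + 2 ^ t = 2 ^ s2 + 2 ^ s\<close>. A sum of two powers of 2 determines the powers up
  to order here, so \<open>s \<noteq> t\<close> forces \<open>s1 = s\<close>, which is
  excluded.\<close>

lemma blocked_once:
  fixes c :: "'d::finite"
  assumes st: "s < 3" "t < 3" "s \<noteq> t"
    and 1: "u \<in> region n g c s" "inbox n e1 s1 (u - g + \<rho>)" "s1 < 3" "\<not> (e1 = c \<and> s1 = s)"
    and 2: "w \<in> region n g c t" "inbox n e2 s2 (w - g + \<rho>)" "s2 < 3" "\<not> (e2 = c \<and> s2 = t)"
  shows False
proof -
  have D: "boxpos e1 s1 k - boxpos c s k = boxpos e2 s2 k - boxpos c t k" for k
  proof -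
    let ?Q = "q (Suc n)" let ?M = "q (Suc (Suc n))"
    have Q: "0 < ?Q" "?M = 8193 * ?Q" by (auto simp: q_pos q_Suc[of "Suc n"])
    obtain j where j: "\<bar>\<rho> $ k - (boxpos e1 s1 k - boxpos c s k) * ?Q - j * ?M\<bar> < 32 * ?Q"
      using blocked_offset[OF 1(1,2)] by blast
    obtain i where i: "\<bar>\<rho> $ k - (boxpos e2 s2 k - boxpos c t k) * ?Q - i * ?M\<bar> < 32 * ?Q"
      using blocked_offset[OF 2(1,2)] by blast
    define E where "E = (boxpos e1 s1 k - boxpos c s k) - (boxpos e2 s2 k - boxpos c t k)"
    have "E * ?Q + (j - i) * ?M = (\<rho> $ k - (boxpos e2 s2 k - boxpos c t k) * ?Q - i * ?M)
        - (\<rho> $ k - (boxpos e1 s1 k - boxpos c s k) * ?Q - j * ?M)"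
      unfolding E_def by (simp add: algebra_simps)
    then have "\<bar>E * ?Q + (j - i) * ?M\<bar> < 64 * ?Q" using i j by linarith
    moreover have "E * ?Q + (j - i) * ?M = (E + (j - i) * 8193) * ?Q" using Q by (simp add: algebra_simps)
    ultimately have "\<bar>E + (j - i) * 8193\<bar> * ?Q < 64 * ?Q" using Q by (simp add: abs_mult)
    then have "\<bar>E + (j - i) * 8193\<bar> < 64" using Q by (simp add: mult_less_cancel_right)
    moreover have "\<bar>E\<bar> \<le> 1024" using boxpos_bounds[OF 1(3), of e1 k] boxpos_bounds[OF 2(3), of e2 k]
      boxpos_bounds[OF st(1), of c k] boxpos_bounds[OF st(2), of c k] unfolding E_def by linarith
    moreover define J where "J = j - i"
    ultimately have J: "\<bar>E + J * 8193\<bar> < 64" "\<bar>E\<bar> \<le> 1024" by simp_all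
    \<comment> \<open>With \<open>E\<close> at most 1024 in size no nonzero multiple of 8193 fits.
      Then \<open>E\<close> is a multiple of 128 of size below 64, hence 0.\<close>
    then have "J < 1" "- 1 < J" by linarith+
    then have "\<bar>E\<bar> < 64" using J by simp
    moreover define m where "m = ((if k = e1 then 2 ^ s1 else 0) - (if k = c then 2 ^ s else 0)
        - (if k = e2 then 2 ^ s2 else 0) + (if k = c then 2 ^ t else 0 :: int))"
    moreover have "E = 128 * m" unfolding E_def m_def boxpos_def by auto
    ultimately have "E = 128 * m" "\<bar>128 * m\<bar> < 64" by simp_all
    then have "m < 1" "- 1 < m" by linarith+
    then have "E = 0" using \<open>E = 128 * m\<close> by simp
    then show ?thesis unfolding E_def by simp
  qed
  have "e1 = c"
    using D[of c] D[of e1] D[of e2] 1(3) 2(3) st by (auto simp: boxpos_def less3 split: if_splits)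
  moreover have "e2 = c"
    using D[of c] D[of e1] D[of e2] 1(3) 2(3) st by (auto simp: boxpos_def less3 split: if_splits)
  ultimately show False using D[of c] 1(3,4) 2(3,4) st by (auto simp: boxpos_def less3 split: if_splits)
qed

text \<open>The two offsets differ by 16 or 32 units of \<open>q n\<close> up to sign, whereas
  nearly zero ones differ by less than 2 units modulo 8193 units.\<close>

lemma not_both_near0:
  assumes "s < 3" "t < 3" "s \<noteq> t" "near0 n (\<rho> - axis c (Y n s))" "near0 n (\<rho> - axis c (Y n t))"
  shows False
proof -
  obtain j where j: "8 * \<bar>\<rho> $ c - Y n s - j * q (Suc n)\<bar> < 7 * q n"
    using assms(4) unfolding near0_def by (metis axis_nth vector_minus_component)
  obtain i where i: "8 * \<bar>\<rho> $ c - Y n t - i * q (Suc n)\<bar> < 7 * q n"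
    using assms(5) unfolding near0_def by (metis axis_nth vector_minus_component)
  define E where "E = 16 * (int s - int t) + 8193 * (j - i)"
  define a b where ab: "a = \<rho> $ c - Y n t - i * q (Suc n)" "b = \<rho> $ c - Y n s - j * q (Suc n)"
  have "E * q n = a - b" unfolding E_def Y_def q_Suc ab by (simp add: algebra_simps)
  moreover have "8 * \<bar>a\<bar> < 7 * q n" "8 * \<bar>b\<bar> < 7 * q n" using i j by (simp_all add: ab)
  ultimately have "\<bar>E * q n\<bar> < 2 * q n" using q_pos[of n] by (smt (verit))
  then have "\<bar>E\<bar> * q n < 2 * q n" using q_pos[of n] by (simp add: abs_mult)
  then have "\<bar>E\<bar> < 2" using q_pos[of n] by (simp add: mult_less_cancel_right)
  moreover define J where "J = j - i"
  ultimately have "\<bar>16 * (int s - int t) + 8193 * J\<bar> < 2" by (simp add: E_def)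
  moreover define D where "D = int s - int t"
  ultimately have E2: "\<bar>16 * D + 8193 * J\<bar> < 2" by simp
  have D: "\<bar>D\<bar> \<le> 2" "D \<noteq> 0" using assms(1-3) by (auto simp: D_def)
  have "J < 1" using E2 D(1) by linarith
  moreover have "- 1 < J" using E2 D(1) by linarith
  ultimately have "\<bar>16 * D\<bar> < 2" using E2 by simp
  then show False using D(2) by linarith
qed

text \<open>Of the three indices at most one is blocked, and of two unblocked ones at most one
  produces a nearly zero offset.\<close>

lemma see_step:
  fixes p1 p2 :: "nat \<Rightarrow> int ^ 'd \<Rightarrow> int ^ 'd"
  assumes p: "phases p1" "phases p2" and nar: "narrow p1 p2 (Suc n) \<rho>" and far: "\<not> near0 (Suc n) \<rho>"
  shows "\<exists>s<3. narrow p1 p2 n (\<rho> - axis c (Y n s)) \<and> \<not> near0 n (\<rho> - axis c (Y n s))"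
proof -
  obtain g where g: "\<And>u. u \<in> window (Suc n) g \<Longrightarrow>
     vcong (Suc n) (p1 (Suc n) u) (u - g) \<and> vcong (Suc n) (p2 (Suc n) u) (u - g + \<rho>)"
    using nar unfolding narrow_def by blast
  define bad where "bad s \<longleftrightarrow> (\<exists>u e t. u \<in> region n g c s \<and> t < 3 \<and> inbox n e t (u - g + \<rho>) \<and> \<not> (e = c \<and> t = s))" for s
  have ok: "narrow p1 p2 n (\<rho> - axis c (Y n s))" if "s < 3" "\<not> bad s" for s
    by (rule see_unblocked[OF p g far that(1)]) (use that(2) in \<open>auto simp: bad_def\<close>)
  have "\<not> (bad s \<and> bad t)" if "s < 3" "t < 3" "s \<noteq> t" for s t
    using blocked_once[OF that] unfolding bad_def by blast
  then obtain s t where "s < 3" "t < 3" "s \<noteq> t" "\<not> bad s" "\<not> bad t"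
    by (metis less3 zero_neq_one zero_neq_numeral one_eq_numeral_iff num.distinct(1))
  then show ?thesis using ok not_both_near0 by blast
qed

section \<open>Dense pairs, freeness and recurrence\<close>

text \<open>Each use of \<open>see_step\<close> descends one level and subtracts \<open>V l\<close>
  modulo \<open>q (Suc l)\<close> along a chosen axis. \<open>f k\<close> counts the uses of axis
  \<open>k\<close>, and the bound on \<open>n\<close> keeps all of them above level
  \<open>l\<close>.\<close>

lemma reach:
  fixes p1 p2 :: "nat \<Rightarrow> int ^ 'd \<Rightarrow> int ^ 'd"
  assumes p: "phases p1" "phases p2"
  shows "narrow p1 p2 n \<rho> \<Longrightarrow> \<not> near0 n \<rho> \<Longrightarrow> sum f UNIV = m \<Longrightarrow> l + 1 + m \<le> n \<Longrightarrow>
    \<exists>n' \<rho>'. l < n' \<and> narrow p1 p2 n' \<rho>' \<and> vcong l \<rho>' (\<rho> - (\<chi> k. V l * int (f k)))"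
proof (induction m arbitrary: n \<rho> f)
  case 0
  then have "(\<chi> k. V l * int (f k)) = 0" by (simp add: vec_eq_iff)
  then show ?case using 0 by (intro exI[of _ n] exI[of _ \<rho>]) simp
next
  case (Suc m)
  obtain c where c: "0 < f c" using Suc.prems(3) by (metis Suc_neq_Zero gr0I sum.neutral)
  define f' where "f' = f(c := f c - 1)"
  have "sum f UNIV = f c + sum f (UNIV - {c})" by (simp add: sum.remove)
  moreover have "sum f' UNIV = f' c + sum f' (UNIV - {c})" by (simp add: sum.remove)
  moreover have "sum f' (UNIV - {c}) = sum f (UNIV - {c})" by (rule sum.cong) (auto simp: f'_def)
  ultimately have m: "sum f' UNIV = m" using c Suc.prems(3) by (simp add: f'_def)
  obtain n1 where n1: "n = Suc n1" using Suc.prems(4) by (cases n) auto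
  obtain s where s: "narrow p1 p2 n1 (\<rho> - axis c (Y n1 s))" "\<not> near0 n1 (\<rho> - axis c (Y n1 s))"
    using see_step[OF p, of n1 \<rho> c] Suc.prems(1,2) n1 by blast
  obtain n' \<rho>' where r: "l < n'" "narrow p1 p2 n' \<rho>'"
    "vcong l \<rho>' (\<rho> - axis c (Y n1 s) - (\<chi> k. V l * int (f' k)))"
    using Suc.IH[OF s m] Suc.prems(4) n1 by auto
  have "l < n1" using Suc.prems(4) n1 by simp
  then have "vcong l (\<rho> - axis c (Y n1 s) - (\<chi> k. V l * int (f' k))) (\<rho> - axis c (V l) - (\<chi> k. V l * int (f' k)))"
    by (intro vcong_diff vcong_refl axis_Y_vcong)
  moreover have "\<rho> - axis c (V l) - (\<chi> k. V l * int (f' k)) = \<rho> - (\<chi> k. V l * int (f k))"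
  proof -
    have "(if k = c then V l else 0) + V l * int (f' k) = V l * int (f k)" for k
    proof (cases "k = c")
      case True
      have "int (f c - 1) = int (f c) - 1" using c by simp
      then have "int (f' c) = int (f c) - 1" by (simp add: f'_def)
      then show ?thesis using True by (simp only: if_True right_diff_distrib) simp
    qed (simp add: f'_def)
    then show ?thesis by (simp add: vec_eq_iff axis_def diff_diff_eq)
  qed
  ultimately have "vcong l \<rho>' (\<rho> - (\<chi> k. V l * int (f k)))"
    using vcong_trans[OF r(3)] by simp
  then show ?case using r(1,2) by blast
qed

lemma narrow_wide_le:
  assumes p: "phases p1" "phases p2" and "narrow p1 p2 n \<rho>" "l < n"
  shows "wide p1 p2 l \<rho>"
proof -
  have "Suc l \<le> n" using assms(4) by simp
  then have "narrow p1 p2 (Suc l) \<rho>"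
  proof (induction rule: inc_induct)
    case (step m)
    then show ?case using narrow_wide[OF p] wide_narrow by blast
  qed (use assms(3) in simp)
  then show ?thesis using narrow_wide[OF p] by blast
qed

text \<open>As \<open>V l\<close> is invertible modulo \<open>q (Suc l)\<close>, suitable numbers of
  steps along the axes turn any offset into \<open>\<kappa>\<close>. These numbers are bounded
  independently of \<open>\<rho>\<close>, so a high enough starting level can be fixed
  first.\<close>

lemma hit:
  fixes p1 p2 :: "nat \<Rightarrow> int ^ 'd \<Rightarrow> int ^ 'd"
  assumes p: "phases p1" "phases p2"
    and far: "\<And>n0. \<exists>n\<ge>n0. \<exists>\<rho>. narrow p1 p2 n \<rho> \<and> \<not> near0 n \<rho>"
  shows "wide p1 p2 l \<kappa>"
proof -
  obtain n \<rho> where n: "l + 1 + CARD('d) * nat (q (Suc l)) \<le> n" "narrow p1 p2 n \<rho>" "\<not> near0 n \<rho>"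
    using far by blast
  obtain x where x: "[V l * x = 1] (mod q (Suc l))" using cong_solve_coprime_int[OF V_coprime] by blast
  define f where "f k = nat ((x * (\<rho> $ k - \<kappa> $ k)) mod q (Suc l))" for k
  have f: "int (f k) = (x * (\<rho> $ k - \<kappa> $ k)) mod q (Suc l)" for k
    using q_pos[of "Suc l"] by (simp add: f_def)
  have "f k \<le> nat (q (Suc l))" for k using q_pos[of "Suc l"] by (simp add: f_def less_imp_le)
  then have "sum f UNIV \<le> CARD('d) * nat (q (Suc l))" using sum_bounded_above[of UNIV f "nat (q (Suc l))"] by simp
  then have "l + 1 + sum f UNIV \<le> n" using n(1) by linarith
  then obtain n' \<rho>' where r: "l < n'" "narrow p1 p2 n' \<rho>'" "vcong l \<rho>' (\<rho> - (\<chi> k. V l * int (f k)))"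
    using reach[OF p n(2,3) refl] by blast
  have "[V l * int (f k) = \<rho> $ k - \<kappa> $ k] (mod q (Suc l))" for k
  proof -
    have "[V l * int (f k) = V l * (x * (\<rho> $ k - \<kappa> $ k))] (mod q (Suc l))"
      unfolding f by (simp add: cong_def mod_mult_right_eq)
    moreover have "[V l * x * (\<rho> $ k - \<kappa> $ k) = 1 * (\<rho> $ k - \<kappa> $ k)] (mod q (Suc l))"
      using x by (intro cong_mult cong_refl)
    ultimately show ?thesis by (metis cong_trans mult.assoc mult_1)
  qed
  then have "vcong l (\<chi> k. V l * int (f k)) (\<rho> - \<kappa>)" by (simp add: vcong_def)
  from vcong_diff[OF vcong_refl this, of \<rho>] have "vcong l \<rho>' \<kappa>" using r(3) vcong_trans by fastforce
  then show ?thesis using narrow_wide_le[OF p r(2,1)] wide_vcong by blast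
qed

lemma align:
  fixes a \<tau> t :: "int ^ 'd"
  shows "\<exists>g. (\<forall>k. a $ k + R \<le> g $ k \<and> g $ k < a $ k + R + q (Suc n)) \<and> vcong n (g + \<tau>) t"
proof -
  define g where "g = (\<chi> k. a $ k + R + (t $ k - \<tau> $ k - a $ k - R) mod q (Suc n))"
  have "vcong n (g + \<tau>) t"
    unfolding vcong_def cong_iff_dvd_diff by (simp add: g_def minus_div_mult_eq_mod[symmetric])
  moreover have "a $ k + R \<le> g $ k" "g $ k < a $ k + R + q (Suc n)" for k
    using q_pos[of "Suc n"] by (simp_all add: g_def)
  ultimately show ?thesis by blast
qed

lemma ex_big_level:
  fixes S :: "(int ^ 'd) set"
  assumes "finite S"
  shows "\<exists>L. l \<le> L \<and> 2 * R \<le> q (Suc L) \<and> (\<forall>u\<in>S. \<forall>k. \<bar>u $ k\<bar> \<le> q (Suc L))"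
proof -
  obtain T where T: "\<And>u k. u \<in> S \<Longrightarrow> \<bar>u $ k\<bar> \<le> T" using ex_bound_finite[OF assms] by blast
  define L where "L = l + nat \<bar>2 * R\<bar> + nat \<bar>T\<bar>"
  have "int L < q (Suc L)" using q_gt[of L] q_mono[of L "Suc L"] by simp
  then have "2 * R \<le> q (Suc L)" "T \<le> q (Suc L)" unfolding L_def by linarith+
  moreover have "l \<le> L" by (simp add: L_def)
  ultimately show ?thesis using T by (intro exI[of _ L]) (meson order_trans)
qed

text \<open>At level \<open>L\<close> all positions involved are close to the origin, where
  \<open>base L\<close> is the identity; a single congruence at that level then yields all lower
  ones.\<close>

lemma base_pattern:
  assumes p: "phases p" and g: "vcong L (p L (u + g)) (u + t)" and "l \<le> L" "n \<le> l"
    and R: "\<And>k. \<bar>u $ k\<bar> \<le> R" "2 * R \<le> q (Suc L)" "\<And>k. \<bar>t $ k\<bar> \<le> q (Suc L)"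
  shows "vcong n (p n (u + g)) (base n (u + t))"
proof -
  have "base L (u + t) = u + t"
  proof (rule base_id)
    fix k show "\<bar>(u + t) $ k\<bar> \<le> 2000 * q (Suc L)"
      using R(1)[of k] R(2) R(3)[of k] q_pos[of "Suc L"] unfolding vector_add_component by linarith
  qed
  then show ?thesis using phases_level[OF p phases_base, of L "u + g" "u + t" n] g assms(3,4) by simp
qed

text \<open>\<open>hit\<close> realises the offset \<open>t2 - t1\<close> on a cube. At a position
  \<open>g\<close> of this cube where the first phase is \<open>t1\<close>, both patterns appear
  together.\<close>

lemma dense_pair:
  fixes p1 p2 :: "nat \<Rightarrow> int ^ 'd \<Rightarrow> int ^ 'd"
  assumes p: "phases p1" "phases p2"
    and far: "\<And>n0. \<exists>n\<ge>n0. \<exists>\<rho>. narrow p1 p2 n \<rho> \<and> \<not> near0 n \<rho>"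
  shows "\<exists>g. \<forall>n\<le>l. \<forall>u. (\<forall>k. \<bar>u $ k\<bar> \<le> R) \<longrightarrow>
     vcong n (p1 n (u + g)) (base n (u + t1)) \<and> vcong n (p2 n (u + g)) (base n (u + t2))"
proof -
  have "finite {t1, t2}" by simp
  then obtain L where L: "l \<le> L" "2 * R \<le> q (Suc L)"
      and T: "\<forall>u\<in>{t1, t2}. \<forall>k. \<bar>u $ k\<bar> \<le> q (Suc L)"
    using ex_big_level by blast
  have t: "\<bar>t1 $ k\<bar> \<le> q (Suc L)" "\<bar>t2 $ k\<bar> \<le> q (Suc L)" for k using T by simp_all
  obtain a \<tau> where w: "\<And>u. u \<in> cube a (2 * q (Suc L)) \<Longrightarrow>
     vcong L (p1 L u) (u + \<tau>) \<and> vcong L (p2 L u) (u + \<tau> + (t2 - t1))"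
    using hit[OF p far, of L "t2 - t1"] unfolding wide_def by blast
  obtain g where "\<forall>k. a $ k + R \<le> g $ k \<and> g $ k < a $ k + R + q (Suc L)" and g3: "vcong L (g + \<tau>) t1"
    using align by blast
  then have g: "a $ k + R \<le> g $ k" "g $ k < a $ k + R + q (Suc L)" for k by auto
  have "vcong n (p1 n (u + g)) (base n (u + t1)) \<and> vcong n (p2 n (u + g)) (base n (u + t2))"
    if n: "n \<le> l" and u: "\<And>k. \<bar>u $ k\<bar> \<le> R" for n u
  proof -
    have "u + g \<in> cube a (2 * q (Suc L))"
    proof -
      have "a $ k \<le> u $ k + g $ k \<and> u $ k + g $ k < a $ k + 2 * q (Suc L)" for k
        using g(1)[of k] g(2)[of k] u[of k] L(2) by linarith
      then show ?thesis by (simp add: cube_def)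
    qed
    note wu = w[OF this]
    have e: "vcong L (u + g + \<tau>) (u + t1)"
      using vcong_add[OF vcong_refl g3, of u] by (simp add: add.assoc)
    have "vcong L (u + g + \<tau> + (t2 - t1)) (u + t2)"
      using vcong_add[OF e vcong_refl, of "t2 - t1"] by (simp add: algebra_simps)
    then have "vcong L (p1 L (u + g)) (u + t1)" "vcong L (p2 L (u + g)) (u + t2)"
      using wu e vcong_trans by blast+
    then show ?thesis
      using base_pattern[OF p(1) _ L(1) n u L(2) t(1)] base_pattern[OF p(2) _ L(1) n u L(2) t(2)] by blast
  qed
  then show ?thesis by (intro exI[of _ g]) blast
qed

section \<open>Untorn cubes, freeness and recurrence\<close>

lemma split_cells:
  fixes b :: "int ^ 'd"
  assumes "0 \<le> r"
  obtains b' i where "cube b' r \<subseteq> cube b (3 * r)" "\<And>u. u \<in> cube b' r \<Longrightarrow> cells n A A' (u + \<tau>) \<longleftrightarrow> i"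
proof -
  let ?Q = "q (Suc n)"
  have Q: "0 < ?Q" by (rule q_pos)
  have cel: "cells n A A' (u + \<tau>) \<longleftrightarrow> (\<forall>k. A $ k * ?Q \<le> u $ k + \<tau> $ k \<and> u $ k + \<tau> $ k < A' $ k * ?Q)" for u
    by (simp add: cells_def le_div_iff_int[OF Q] div_less_iff_int[OF Q])
  have sub: "cube (\<chi> k. b $ k + e) r \<subseteq> cube b (3 * r)" if "0 \<le> e" "e \<le> 2 * r" for e
  proof
    fix u assume u: "u \<in> cube (\<chi> k. b $ k + e) r"
    have "b $ k \<le> u $ k \<and> u $ k < b $ k + 3 * r" for k
    proof -
      have "b $ k + e \<le> u $ k" "u $ k < b $ k + e + r" using u by (auto simp: cube_def)
      then show ?thesis using that by linarith
    qed
    then show "u \<in> cube b (3 * r)" by (simp add: cube_def)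
  qed
  \<comment> \<open>If the block begins after the first third or ends before the last third along
    some axis, that corner cube misses it; otherwise the middle third lies inside along every
    axis.\<close>
  consider k where "b $ k + \<tau> $ k + r \<le> A $ k * ?Q" | k where "A' $ k * ?Q \<le> b $ k + \<tau> $ k + 2 * r"
    | "\<And>k. A $ k * ?Q < b $ k + \<tau> $ k + r \<and> b $ k + \<tau> $ k + 2 * r < A' $ k * ?Q"
    by (meson linorder_not_less)
  then show ?thesis
  proof cases
    case (1 k)
    have "\<not> cells n A A' (u + \<tau>)" if "u \<in> cube (\<chi> k. b $ k + 0) r" for u
    proof -
      have "u $ k < b $ k + r" using that by (auto simp: cube_def)
      then show ?thesis unfolding cel using 1 by (smt (verit))
    qed
    then show ?thesis using that[of "\<chi> k. b $ k + 0" False] sub[of 0] assms by auto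
  next
    case (2 k)
    have "\<not> cells n A A' (u + \<tau>)" if "u \<in> cube (\<chi> k. b $ k + 2 * r) r" for u
    proof -
      have "b $ k + 2 * r \<le> u $ k" using that by (auto simp: cube_def)
      then show ?thesis unfolding cel using 2 by (smt (verit))
    qed
    then show ?thesis using that[of "\<chi> k. b $ k + 2 * r" False] sub[of "2 * r"] assms by auto
  next
    case 3
    have "cells n A A' (u + \<tau>)" if "u \<in> cube (\<chi> k. b $ k + r) r" for u
    proof -
      have "b $ k + r \<le> u $ k \<and> u $ k < b $ k + 2 * r" for k
        using that by (auto simp: cube_def dest: spec[of _ k])
      then show ?thesis unfolding cel using 3 by (smt (verit))
    qed
    then show ?thesis using that[of "\<chi> k. b $ k + r" True] sub[of r] assms by auto
  qed
qed

lemma cube_mono: "r \<le> s \<Longrightarrow> cube a r \<subseteq> cube a s"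
  by (auto simp: cube_def) (smt (verit))

lemma untorn_cube:
  assumes p: "phases p" and r: "0 \<le> r" "3 * r \<le> 32 * q (Suc n)"
  shows "\<exists>b' \<tau>. cube b' r \<subseteq> cube b (3 * r) \<and> (\<forall>u\<in>cube b' r. vcong n (p n u) (u + \<tau>))"
proof -
  obtain \<tau> A A' c s where f: "\<And>u. u \<in> cube b (32 * q (Suc n)) \<Longrightarrow>
     vcong n (p n u) (u + \<tau> + (if cells n A A' (u + \<tau>) then axis c (Y n s) else 0))"
    using phases_one_tear[OF p, of n b] unfolding one_tear_def by blast
  obtain b' i where b': "cube b' r \<subseteq> cube b (3 * r)" "\<And>u. u \<in> cube b' r \<Longrightarrow> cells n A A' (u + \<tau>) \<longleftrightarrow> i"
    using split_cells[OF r(1)] by metis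
  have "vcong n (p n u) (u + (\<tau> + (if i then axis c (Y n s) else 0)))" if "u \<in> cube b' r" for u
    using f[of u] b' that cube_mono[OF r(2), of b] by (auto simp: add.assoc)
  then show ?thesis using b'(1) by blast
qed

text \<open>At a level whose cubes are larger than \<open>g\<close>, an untorn cube holds two
  positions \<open>u\<close> and \<open>u + g\<close>. Their phases differ by \<open>g\<close>, and
  a nonzero vector of this size is not congruent to 0.\<close>

lemma phases_free:
  fixes p :: "nat \<Rightarrow> int ^ 'd \<Rightarrow> int ^ 'd"
  assumes p: "phases p" and "g \<noteq> 0"
  shows "\<exists>n u. \<not> vcong n (p n (u + g)) (p n u)"
proof (rule ccontr)
  assume "\<not> ?thesis"
  then have eq: "\<And>n u. vcong n (p n (u + g)) (p n u)" by blast
  have "finite {g}" by simp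
  then obtain L where T: "\<forall>u\<in>{g}. \<forall>k. \<bar>u $ k\<bar> \<le> q (Suc L)"
    using ex_big_level by blast
  have L: "\<bar>g $ k\<bar> \<le> q (Suc L)" for k using T by simp
  let ?n = "Suc L" let ?M = "q (Suc ?n)"
  have M: "\<bar>g $ k\<bar> < ?M" for k using L[of k] q_pos[of "Suc L"] unfolding q_Suc[of "Suc L"] by linarith
  obtain b \<tau> where b: "\<And>u. u \<in> cube b (2 * ?M) \<Longrightarrow> vcong ?n (p ?n u) (u + \<tau>)"
  proof -
    have "0 \<le> 2 * ?M" "3 * (2 * ?M) \<le> 32 * ?M" using q_pos[of "Suc ?n"] by simp_all
    from untorn_cube[OF p this] show ?thesis using that by blast
  qed
  define u where "u = (\<chi> k. b $ k + ?M)"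
  have "u \<in> cube b (2 * ?M)" "u + g \<in> cube b (2 * ?M)"
  proof -
    have "b $ k \<le> u $ k \<and> u $ k < b $ k + 2 * ?M \<and> b $ k \<le> u $ k + g $ k \<and> u $ k + g $ k < b $ k + 2 * ?M" for k
      using M[of k] q_pos[of "Suc ?n"] unfolding u_def vec_lambda_beta by linarith
    then show "u \<in> cube b (2 * ?M)" "u + g \<in> cube b (2 * ?M)" by (auto simp: cube_def)
  qed
  then have "vcong ?n (u + g + \<tau>) (u + \<tau>)" using b eq vcong_sym vcong_trans by meson
  then have "[u $ k + g $ k + \<tau> $ k = u $ k + \<tau> $ k] (mod ?M)" for k by (auto simp: vcong_def)
  then have "?M dvd g $ k" for k by (simp add: cong_iff_dvd_diff)
  then have "g $ k = 0" for k using dvd_imp_le_int[of "g $ k" ?M] M[of k] by (cases "g $ k = 0") auto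
  then show False using assms(2) by (simp add: vec_eq_iff)
qed

text \<open>Around 0 the point looks like \<open>base\<close> around some \<open>t\<close>. Every
  untorn cube of a high level contains a position of phase \<open>t\<close>, and the pattern recurs
  there.\<close>

lemma recurrence:
  fixes p :: "nat \<Rightarrow> int ^ 'd \<Rightarrow> int ^ 'd"
  assumes p: "phases p"
  shows "\<exists>g. g \<noteq> 0 \<and> (\<forall>n\<le>l. \<forall>u. (\<forall>k. \<bar>u $ k\<bar> \<le> R) \<longrightarrow> vcong n (p n (u + g)) (p n u))"
proof -
  obtain t where t: "\<And>n u. n \<le> l \<Longrightarrow> (\<And>k. \<bar>u $ k\<bar> \<le> \<bar>R\<bar>) \<Longrightarrow> vcong n (p n u) (base n (u + t))"
    using phasesE[OF p] by blast
  have "finite {t}" by simp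
  then obtain L where L: "l \<le> L" "2 * \<bar>R\<bar> \<le> q (Suc L)"
      and T: "\<forall>u\<in>{t}. \<forall>k. \<bar>u $ k\<bar> \<le> q (Suc L)"
    using ex_big_level by blast
  have tL: "\<bar>t $ k\<bar> \<le> q (Suc L)" for k using T by simp
  \<comment> \<open>Placing the search cube at the corner with all coordinates 1 makes every
    coordinate of \<open>g\<close> positive, hence \<open>g \<noteq> 0\<close>.\<close>
  obtain b \<tau> where b: "cube b (2 * q (Suc L)) \<subseteq> cube (\<chi> k. 1) (3 * (2 * q (Suc L)))"
     "\<And>u. u \<in> cube b (2 * q (Suc L)) \<Longrightarrow> vcong L (p L u) (u + \<tau>)"
  proof -
    have "0 \<le> 2 * q (Suc L)" "3 * (2 * q (Suc L)) \<le> 32 * q (Suc L)" using q_pos[of "Suc L"] by simp_all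
    from untorn_cube[OF p this] show ?thesis using that by blast
  qed
  obtain g where "\<forall>k. b $ k + \<bar>R\<bar> \<le> g $ k \<and> g $ k < b $ k + \<bar>R\<bar> + q (Suc L)" and g3: "vcong L (g + \<tau>) t"
    using align by blast
  then have g: "b $ k + \<bar>R\<bar> \<le> g $ k" "g $ k < b $ k + \<bar>R\<bar> + q (Suc L)" for k by auto
  have "b \<in> cube b (2 * q (Suc L))" using q_pos[of "Suc L"] by (simp add: cube_def)
  then have "b \<in> cube (\<chi> k. 1) (3 * (2 * q (Suc L)))" using b(1) by blast
  then have "1 \<le> b $ k" for k by (simp add: cube_def)
  then have "0 < g $ undefined" using g(1)[of undefined] by (smt (verit))
  then have "g \<noteq> 0" by auto
  moreover have "vcong n (p n (u + g)) (p n u)" if n: "n \<le> l" and u: "\<And>k. \<bar>u $ k\<bar> \<le> R" for n u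
  proof -
    have u': "\<bar>u $ k\<bar> \<le> \<bar>R\<bar>" for k using u[of k] by linarith
    have "u + g \<in> cube b (2 * q (Suc L))"
    proof -
      have "b $ k \<le> u $ k + g $ k \<and> u $ k + g $ k < b $ k + 2 * q (Suc L)" for k
        using g(1)[of k] g(2)[of k] u'[of k] L(2) by linarith
      then show ?thesis by (simp add: cube_def)
    qed
    moreover have "vcong L (u + g + \<tau>) (u + t)"
      using vcong_add[OF vcong_refl g3, of u] by (simp add: add.assoc)
    ultimately have "vcong L (p L (u + g)) (u + t)" using b(2) vcong_trans by blast
    then have "vcong n (p n (u + g)) (base n (u + t))"
      using base_pattern[OF p _ L(1) n u' L(2) tL] by blast
    then show ?thesis using t[OF n u'] vcong_sym vcong_trans by blast
  qed
  ultimately show ?thesis by blast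
qed

section \<open>Pairs with nearly vanishing offsets\<close>

definition vdiv :: "nat \<Rightarrow> int ^ 'd \<Rightarrow> int ^ 'd" where
  "vdiv n \<theta> = (\<chi> k. \<theta> $ k div q (Suc n))"

text \<open>An arbitrary set \<open>J\<close> of cell indices replaces the block of
  \<open>one_tear\<close>, so that the cells can be renumbered freely.\<close>

definition tear_form :: "nat \<Rightarrow> (int ^ 'd \<Rightarrow> int ^ 'd) \<Rightarrow> (int ^ 'd) set \<Rightarrow> int ^ 'd \<Rightarrow> (int ^ 'd \<Rightarrow> bool) \<Rightarrow> int ^ 'd \<Rightarrow> bool" where
  "tear_form n f C \<tau> J w \<longleftrightarrow>
     (\<forall>u\<in>C. vcong n (f u) (u + \<tau> + (if J (vdiv n (u + \<tau>)) then w else 0)))"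

lemma cells_vdiv: "cells n A A' \<theta> \<longleftrightarrow> (\<forall>k. A $ k \<le> vdiv n \<theta> $ k \<and> vdiv n \<theta> $ k < A' $ k)"
  by (simp add: cells_def vdiv_def)

lemma vdiv_eqI:
  assumes "\<And>k. q (Suc n) * m $ k \<le> \<theta> $ k \<and> \<theta> $ k < q (Suc n) * m $ k + q (Suc n)"
  shows "vdiv n \<theta> = m"
proof -
  have "\<theta> $ k div q (Suc n) = m $ k" for k
  proof -
    have "m $ k \<le> \<theta> $ k div q (Suc n)" "\<theta> $ k div q (Suc n) < m $ k + 1"
      using assms[of k] by (simp_all add: le_div_iff_int[OF q_pos] div_less_iff_int[OF q_pos] algebra_simps)
    then show ?thesis by simp
  qed
  then show ?thesis by (simp add: vdiv_def vec_eq_iff)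
qed

lemma vdiv_bounds: "q (Suc n) * vdiv n \<theta> $ k \<le> \<theta> $ k \<and> \<theta> $ k < q (Suc n) * vdiv n \<theta> $ k + q (Suc n)"
  using mult_div_mod_eq[of "q (Suc n)" "\<theta> $ k"] q_pos[of "Suc n"]
    pos_mod_sign[of "q (Suc n)" "\<theta> $ k"] pos_mod_bound[of "q (Suc n)" "\<theta> $ k"]
  unfolding vdiv_def vec_lambda_beta by linarith

text \<open>Multiples of \<open>q (Suc n)\<close> in \<open>\<tau>\<close> are invisible to the
  phases and only renumber the cells.\<close>

lemma tear_form_shift:
  assumes "tear_form n f C \<tau> J w"
  shows "tear_form n f C (\<tau> - (\<chi> k. j $ k * q (Suc n))) (\<lambda>m. J (m + j)) w"
  unfolding tear_form_def
proof
  fix u assume "u \<in> C"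
  define x :: "int ^ 'a" where "x = (\<chi> k. j $ k * q (Suc n))"
  have "vdiv n (u + (\<tau> - x)) + j = vdiv n (u + \<tau>)"
  proof -
    have "(u $ k + (\<tau> $ k - j $ k * q (Suc n))) div q (Suc n) + j $ k = (u $ k + \<tau> $ k) div q (Suc n)" for k
    proof -
      have "u $ k + (\<tau> $ k - j $ k * q (Suc n)) = u $ k + \<tau> $ k + (- j $ k) * q (Suc n)" by simp
      then show ?thesis using q_pos[of "Suc n"] by (simp only: div_mult_self1)
    qed
    then show ?thesis by (simp add: vdiv_def vec_eq_iff x_def)
  qed
  moreover have "vcong n (f u) (u + \<tau> + (if J (vdiv n (u + \<tau>)) then w else 0))"
    using assms \<open>u \<in> C\<close> by (auto simp: tear_form_def)
  moreover have "vcong n (u + \<tau> + y) (u + (\<tau> - x) + y)" for y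
    by (simp add: vcong_def cong_iff_dvd_diff x_def)
  ultimately show "vcong n (f u) (u + (\<tau> - x) + (if J (vdiv n (u + (\<tau> - x)) + j) then w else 0))"
    using vcong_trans by metis
qed

lemma lt_of_small: "8 * \<bar>x\<bar> < 7 * b \<Longrightarrow> \<bar>x\<bar> < (b :: int)"
  by linarith

lemma diff_of_small: "8 * \<bar>x\<bar> < 7 * b \<Longrightarrow> 8 * \<bar>y\<bar> < 7 * b \<Longrightarrow> \<bar>x - y\<bar> < 2 * (b :: int)"
  by linarith

text \<open>A vector of this size can be near a multiple of \<open>q (Suc n) = 8193 * q n\<close>
  only if the multiple is 0, so \<open>near0\<close> bounds the integers themselves.\<close>

lemma small_offset:
  assumes "\<And>k. \<bar>x $ k\<bar> \<le> 124 * q n" "near0 n x"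
  shows "8 * \<bar>x $ k\<bar> < 7 * q n"
proof -
  obtain j where j: "8 * \<bar>x $ k - j * q (Suc n)\<bar> < 7 * q n" using assms(2) unfolding near0_def by blast
  have Q: "0 < q n" "q (Suc n) = 8193 * q n" by (auto simp: q_pos q_Suc)
  have a: "\<bar>x $ k - j * q (Suc n)\<bar> < q n" using j by (rule lt_of_small)
  have "\<bar>j * q (Suc n)\<bar> < 125 * q n" using a assms(1)[of k] by linarith
  then have "\<bar>j\<bar> * 8193 * q n < 125 * q n" using Q by (simp add: abs_mult)
  then have "\<bar>j\<bar> * 8193 < 125" using Q(1) mult_less_cancel_right_pos by blast
  then have "j = 0" by linarith
  then show ?thesis using j by simp
qed

lemma axis_abs: "s < 3 \<Longrightarrow> \<bar>(if b then axis c (Y n s) else 0) $ k\<bar> \<le> 41 * q n"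
  using Y_bounds[of s n] q_pos[of n] by (auto simp: axis_def)

text \<open>
  The cells \<open>m\<close> with \<open>J1 m\<close>, respectively \<open>J2 m\<close>, are those displaced in the first and in the second point.
  Small offsets force the displacements to agree cell by cell, since they are not nearly zero themselves.
\<close>

lemma rigid_cells:
  fixes t :: "int ^ 'd" and J1 J2 :: "int ^ 'd \<Rightarrow> bool"
  assumes s: "s1 < 3" "s2 < 3" and w: "w1 = axis c1 (Y n s1)" "w2 = axis c2 (Y n s2)"
    and small: "\<And>m k. m \<in> S \<Longrightarrow> 8 * \<bar>(t + (if J2 m then w2 else 0) - (if J1 m then w1 else 0)) $ k\<bar> < 7 * q n"
    and mm: "m \<in> S" "m' \<in> S" "\<not> (J1 m = J1 m' \<and> J2 m = J2 m')"
  shows "w1 = w2 \<and> J1 m = J2 m \<and> J1 m' = J2 m'"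
proof -
  have Q: "0 < q n" by (rule q_pos)
  have diff: "\<bar>((if J2 m then w2 else 0) - (if J1 m then w1 else 0) - (if J2 m' then w2 else 0) + (if J1 m' then w1 else 0)) $ k\<bar> < 2 * q n" for k
    using diff_of_small[OF small[OF mm(1), of k] small[OF mm(2), of k]]
    by (simp add: algebra_simps)
  have w1: "w1 $ c1 \<ge> 8 * q n" "\<And>k. 0 \<le> w1 $ k" and w2: "w2 $ c2 \<ge> 8 * q n" "\<And>k. 0 \<le> w2 $ k"
    using Y_bounds[OF s(1), of n] Y_bounds[OF s(2), of n] Q unfolding w by (auto simp: axis_def)
  show ?thesis
  proof (cases "J1 m = J1 m'")
    case True
    then have "\<bar>w2 $ c2\<bar> < 2 * q n" using diff[of c2] mm(3) by (cases "J1 m"; cases "J2 m") auto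
    then show ?thesis using w2 Q by simp
  next
    case J1: False
    show ?thesis
    proof (cases "J2 m = J2 m'")
      case True
      then have "\<bar>w1 $ c1\<bar> < 2 * q n" using diff[of c1] J1 by (cases "J1 m"; cases "J2 m") auto
      then show ?thesis using w1 Q by simp
    next
      case J2: False
      show ?thesis
      proof (cases "J1 m = J2 m")
        case True
        \<comment> \<open>Both points change in the same sense, so \<open>w2 - w1\<close> is small.
          Different axes would leave at least 8 units of \<open>q n\<close>, different indices at
          least 16.\<close>
        then have d: "\<bar>w2 $ k - w1 $ k\<bar> < 2 * q n" for k
          using diff[of k] J1 J2 by (cases "J1 m") (auto simp: abs_minus_commute)
        have "c1 = c2"
        proof (rule ccontr)
          assume "c1 \<noteq> c2"
          then have "w2 $ c1 = 0" by (simp add: w axis_def)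
          then show False using d[of c1] w1 Q by simp
        qed
        then have "\<bar>Y n s2 - Y n s1\<bar> < 2 * q n" using d[of c1] by (simp add: w)
        moreover have "Y n s2 - Y n s1 = (16 * (int s2 - int s1)) * q n" by (simp add: Y_def algebra_simps)
        ultimately have "\<bar>16 * (int s2 - int s1)\<bar> * q n < 2 * q n" using Q by (simp add: abs_mult)
        then have "\<bar>16 * (int s2 - int s1)\<bar> < 2" using Q mult_less_cancel_right_pos by blast
        moreover define D where "D = int s2 - int s1"
        ultimately have "\<bar>16 * D\<bar> < 2" by simp
        then have "D = 0" by linarith
        then have "s1 = s2" by (simp add: D_def)
        then show ?thesis using True J1 J2 \<open>c1 = c2\<close> w by auto
      next
        case False
        then have "\<bar>w2 $ c1 + w1 $ c1\<bar> < 2 * q n"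
          using diff[of c1] J1 J2 by (cases "J1 m") (auto simp: abs_minus_commute)
        then show ?thesis using w1 w2(2)[of c1] Q by simp
      qed
    qed
  qed
qed

text \<open>The assumption is used first on a common untorn cube, which nearly aligns the two grids,
  and then on each cell of the window. By \<open>rigid_cells\<close> either the displacements of
  both points coincide or they do not vary over the window; in both cases one small translation
  relates the points.\<close>

lemma rigid_level:
  fixes p1 p2 :: "nat \<Rightarrow> int ^ 'd \<Rightarrow> int ^ 'd"
  assumes p: "phases p1" "phases p2" and ex: "\<And>\<sigma>. narrow p1 p2 n \<sigma> \<Longrightarrow> near0 n \<sigma>"
  shows "\<exists>\<rho>. (\<forall>k. 8 * \<bar>\<rho> $ k\<bar> < 7 * q n) \<and>
    (\<forall>u. (\<forall>k. \<bar>u $ k\<bar> \<le> 12 * q (Suc n)) \<longrightarrow> vcong n (p2 n u) (p1 n (u + \<rho>)))"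
proof -
  let ?b = "q n" let ?M = "q (Suc n)"
  have Q: "0 < ?b" "?M = 8193 * ?b" by (auto simp: q_pos q_Suc)
  define C :: "(int ^ 'd) set" where "C = cube (\<chi> k. - 16 * ?M) (32 * ?M)"
  obtain \<tau>1 A1 B1 c1 s1 where s1: "s1 < 3" and f1: "\<And>u. u \<in> C \<Longrightarrow>
     vcong n (p1 n u) (u + \<tau>1 + (if cells n A1 B1 (u + \<tau>1) then axis c1 (Y n s1) else 0))"
    using phases_one_tear[OF p(1), of n "\<chi> k. - 16 * ?M"] unfolding one_tear_def C_def by blast
  obtain \<tau>2 A2 B2 c2 s2 where s2: "s2 < 3" and f2: "\<And>u. u \<in> C \<Longrightarrow>
     vcong n (p2 n u) (u + \<tau>2 + (if cells n A2 B2 (u + \<tau>2) then axis c2 (Y n s2) else 0))"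
    using phases_one_tear[OF p(2), of n "\<chi> k. - 16 * ?M"] unfolding one_tear_def C_def by blast
  define w1 where "w1 = axis c1 (Y n s1)" define w2 where "w2 = axis c2 (Y n s2)"
  define W1 where "W1 b = (if b then w1 else 0)" for b
  define W2 where "W2 b = (if b then w2 else 0)" for b
  have Wb: "\<bar>W1 b $ k\<bar> \<le> 41 * ?b" "\<bar>W2 b $ k\<bar> \<le> 41 * ?b" "0 \<le> W1 b $ k" for b k
    using axis_abs[OF s1, of b c1 n k] axis_abs[OF s2, of b c2 n k] Y_bounds[OF s1, of n] Q
    unfolding W1_def W2_def w1_def w2_def by (auto simp: axis_def)
  define J1 where "J1 m \<longleftrightarrow> (\<forall>k. A1 $ k \<le> m $ k \<and> m $ k < B1 $ k)" for m
  have t1: "tear_form n (p1 n) C \<tau>1 J1 w1"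
    using f1 unfolding tear_form_def J1_def w1_def cells_vdiv by blast
  define J2' where "J2' m \<longleftrightarrow> (\<forall>k. A2 $ k \<le> m $ k \<and> m $ k < B2 $ k)" for m
  have t2': "tear_form n (p2 n) C \<tau>2 J2' w2"
    using f2 unfolding tear_form_def J2'_def w2_def cells_vdiv by blast
  \<comment> \<open>\<open>split_cells\<close> is applied once for each point, and each time divides
    the side by three: 18, 6, 2.\<close>
  have "0 \<le> 6 * ?M" "0 \<le> 2 * ?M" using Q by simp_all
  then obtain b1 i1 where b1: "cube b1 (6 * ?M) \<subseteq> cube (\<chi> k. - 16 * ?M) (3 * (6 * ?M))"
     "\<And>u. u \<in> cube b1 (6 * ?M) \<Longrightarrow> cells n A1 B1 (u + \<tau>1) \<longleftrightarrow> i1"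
    using split_cells by metis
  obtain b2 i2 where b2: "cube b2 (2 * ?M) \<subseteq> cube b1 (3 * (2 * ?M))"
     "\<And>u. u \<in> cube b2 (2 * ?M) \<Longrightarrow> cells n A2 B2 (u + \<tau>2) \<longleftrightarrow> i2"
    using split_cells \<open>0 \<le> 2 * ?M\<close> by metis
  define \<sigma> where "\<sigma> = \<tau>2 + W2 i2 - \<tau>1 - W1 i1"
  have "wide p1 p2 n \<sigma>" unfolding wide_def
  proof (intro exI ballI conjI)
    fix u assume u: "u \<in> cube b2 (2 * ?M)"
    then have u1: "u \<in> cube b1 (6 * ?M)" using b2(1) by auto
    moreover have "cube (\<chi> k. - 16 * ?M) (3 * (6 * ?M)) \<subseteq> C" unfolding C_def using Q by (intro cube_mono) simp
    ultimately have uC: "u \<in> C" using b1(1) by blast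
    show "vcong n (p1 n u) (u + (\<tau>1 + W1 i1))"
      using f1[OF uC] b1(2)[OF u1] by (cases i1) (simp_all add: W1_def w1_def add.assoc)
    show "vcong n (p2 n u) (u + (\<tau>1 + W1 i1) + \<sigma>)"
      using f2[OF uC] b2(2)[OF u] by (cases i2) (simp_all add: W2_def w2_def \<sigma>_def algebra_simps)
  qed
  then have "near0 n \<sigma>" using ex wide_narrow by blast
  then obtain j where j: "\<And>k. 8 * \<bar>\<sigma> $ k - j k * ?M\<bar> < 7 * ?b" unfolding near0_def by metis
  \<comment> \<open>Removing the multiples \<open>j k\<close> of \<open>?M\<close> changes no phase
    and brings the second grid close to the first.\<close>
  define \<tau>' where "\<tau>' = \<tau>2 - (\<chi> k. (\<chi> k. j k) $ k * ?M)"
  define J2 where "J2 m \<longleftrightarrow> J2' (m + (\<chi> k. j k))" for m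
  have t2: "tear_form n (p2 n) C \<tau>' J2 w2"
    using tear_form_shift[OF t2', of "\<chi> k. j k"] unfolding \<tau>'_def J2_def by simp
  define t where "t = \<tau>' - \<tau>1"
  \<comment> \<open>42 = 1 + 41: the reduced offset contributes less than one unit, and two
    displacements between 0 and 41 units differ by at most 41.\<close>
  have tb: "\<bar>t $ k\<bar> \<le> 42 * ?b" for k
  proof -
    have "t $ k = \<sigma> $ k - j k * ?M - W2 i2 $ k + W1 i1 $ k" by (simp add: t_def \<tau>'_def \<sigma>_def)
    moreover have "\<bar>\<sigma> $ k - j k * ?M\<bar> < ?b" using j[of k] by (rule lt_of_small)
    ultimately show ?thesis using Wb(1)[of i1 k] Wb(2)[of i2 k] Wb(3)[of i1 k]
      unfolding W2_def w2_def using Y_bounds[OF s2, of n] Q by (auto simp: axis_def split: if_splits)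
  qed
  \<comment> \<open>\<open>S\<close> indexes the cells of the first grid that lie entirely in
    \<open>C\<close>; \<open>e m\<close> below is the offset of the two points over the cell
    \<open>m\<close>.\<close>
  define S where "S = {m :: int ^ 'd. \<forall>k. - 16 * ?M \<le> ?M * m $ k - \<tau>1 $ k \<and> ?M * m $ k - \<tau>1 $ k + ?M \<le> 16 * ?M}"
  define e where "e m = t + W2 (J2 m) - W1 (J1 m)" for m
  have em: "8 * \<bar>e m $ k\<bar> < 7 * ?b" if m: "m \<in> S" for m k
  proof (rule small_offset)
    fix k show "\<bar>e m $ k\<bar> \<le> 124 * ?b"
      using tb[of k] Wb(1)[of "J1 m" k] Wb(2)[of "J2 m" k]
      unfolding e_def vector_add_component vector_minus_component by linarith
  next
    \<comment> \<open>The corner of the cell \<open>m\<close> as the displaced first point sees it.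
      The window over it is so far from the walls that both points are in the cell \<open>m\<close>
      there.\<close>
    define g where "g = (\<chi> k. ?M * m $ k - \<tau>1 $ k - W1 (J1 m) $ k)"
    have "vcong n (p1 n u) (u - g) \<and> vcong n (p2 n u) (u - g + e m)" if u: "u \<in> window n g" for u
    proof -
      define y where "y k = u $ k + \<tau>1 $ k - ?M * m $ k" for k
      have y: "2007 * ?b \<le> y k \<and> y k < 4096 * ?b" for k
      proof -
        have "2048 * ?b \<le> u $ k - g $ k" "u $ k - g $ k < 4096 * ?b" using u by (auto simp: window_def)
        moreover have "u $ k - g $ k = y k + W1 (J1 m) $ k" by (simp add: g_def y_def)
        ultimately show ?thesis using Wb(1)[of "J1 m" k] Wb(3)[of "J1 m" k] by linarith
      qed
      have uC: "u \<in> C"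
      proof -
        have "- 16 * ?M \<le> u $ k \<and> u $ k < - 16 * ?M + 32 * ?M" for k
        proof -
          have "- 16 * ?M \<le> ?M * m $ k - \<tau>1 $ k" "?M * m $ k - \<tau>1 $ k + ?M \<le> 16 * ?M"
            using m by (auto simp: S_def)
          then show ?thesis using y[of k] Q unfolding y_def by linarith
        qed
        then show ?thesis by (simp add: C_def cube_def)
      qed
      have d1: "vdiv n (u + \<tau>1) = m"
      proof (rule vdiv_eqI)
        fix k show "?M * m $ k \<le> (u + \<tau>1) $ k \<and> (u + \<tau>1) $ k < ?M * m $ k + ?M"
          using y[of k] Q unfolding y_def vector_add_component by linarith
      qed
      have d2: "vdiv n (u + \<tau>') = m"
      proof (rule vdiv_eqI)
        fix k
        have "(u + \<tau>') $ k = y k + t $ k + ?M * m $ k" by (simp add: y_def t_def)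
        then show "?M * m $ k \<le> (u + \<tau>') $ k \<and> (u + \<tau>') $ k < ?M * m $ k + ?M"
          using y[of k] tb[of k] Q by linarith
      qed
      have v: "vcong n (u + \<tau>1 + W1 (J1 m)) (u - g)"
        unfolding vcong_def cong_iff_dvd_diff by (simp add: g_def)
      have "u + \<tau>' + W2 (J2 m) = u + \<tau>1 + W1 (J1 m) + e m" by (simp add: e_def t_def)
      then have "vcong n (u + \<tau>' + W2 (J2 m)) (u - g + e m)" using vcong_add[OF v vcong_refl, of "e m"] by metis
      moreover have "vcong n (p1 n u) (u + \<tau>1 + W1 (J1 m))"
        using t1 uC d1 unfolding tear_form_def W1_def by metis
      moreover have "vcong n (p2 n u) (u + \<tau>' + W2 (J2 m))"
        using t2 uC d2 unfolding tear_form_def W2_def by metis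
      ultimately show ?thesis using v vcong_trans by blast
    qed
    then have "narrow p1 p2 n (e m)" unfolding narrow_def by blast
    then show "near0 n (e m)" by (rule ex)
  qed
  have vS: "vdiv n \<theta> \<in> S" if "\<And>k. \<bar>\<theta> $ k - \<tau>1 $ k\<bar> \<le> 14 * ?M" for \<theta>
  proof -
    have "- 16 * ?M \<le> ?M * vdiv n \<theta> $ k - \<tau>1 $ k \<and> ?M * vdiv n \<theta> $ k - \<tau>1 $ k + ?M \<le> 16 * ?M" for k
      using vdiv_bounds[of n \<theta> k] that[of k] Q by linarith
    then show ?thesis by (simp add: S_def)
  qed
  have inC: "u \<in> C" if "\<And>k. \<bar>u $ k\<bar> \<le> 13 * ?M" for u
  proof -
    have "- 16 * ?M \<le> u $ k \<and> u $ k < - 16 * ?M + 32 * ?M" for k using that[of k] Q by linarith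
    then show ?thesis by (simp add: C_def cube_def)
  qed
  have p1u: "vcong n (p1 n u) (u + \<tau>1 + W1 (J1 (vdiv n (u + \<tau>1)))) \<and> vdiv n (u + \<tau>1) \<in> S"
    if "\<And>k. \<bar>u $ k\<bar> \<le> 13 * ?M" for u
  proof
    show "vcong n (p1 n u) (u + \<tau>1 + W1 (J1 (vdiv n (u + \<tau>1))))"
      using t1 inC[OF that] unfolding tear_form_def W1_def by blast
    show "vdiv n (u + \<tau>1) \<in> S"
    proof (rule vS)
      fix k show "\<bar>(u + \<tau>1) $ k - \<tau>1 $ k\<bar> \<le> 14 * ?M" using that[of k] Q by simp
    qed
  qed
  have p2u: "vcong n (p2 n u) (u + \<tau>' + W2 (J2 (vdiv n (u + \<tau>')))) \<and> vdiv n (u + \<tau>') \<in> S"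
    if "\<And>k. \<bar>u $ k\<bar> \<le> 13 * ?M" for u
  proof
    show "vcong n (p2 n u) (u + \<tau>' + W2 (J2 (vdiv n (u + \<tau>'))))"
      using t2 inC[OF that] unfolding tear_form_def W2_def by blast
    show "vdiv n (u + \<tau>') \<in> S"
    proof (rule vS)
      fix k
      have "(u + \<tau>') $ k - \<tau>1 $ k = u $ k + t $ k" by (simp add: t_def)
      then show "\<bar>(u + \<tau>') $ k - \<tau>1 $ k\<bar> \<le> 14 * ?M" using that[of k] tb[of k] Q by linarith
    qed
  qed
  have add13: "\<bar>(u + \<rho>) $ k\<bar> \<le> 13 * ?M" if "\<bar>u $ k\<bar> \<le> 12 * ?M" "8 * \<bar>\<rho> $ k\<bar> < 7 * ?b" for u \<rho> :: "int ^ 'd" and k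
    using that Q unfolding vector_add_component by linarith
  have small: "8 * \<bar>(t + (if J2 m then w2 else 0) - (if J1 m then w1 else 0)) $ k\<bar> < 7 * ?b" if "m \<in> S" for m k
    using em[OF that, of k] unfolding e_def W1_def W2_def .
  have cmp: "w1 = w2 \<and> J1 m = J2 m \<and> J1 m' = J2 m'"
    if "m \<in> S" "m' \<in> S" "\<not> (J1 m = J1 m' \<and> J2 m = J2 m')" for m m'
    by (rule rigid_cells[OF s1 s2 w1_def w2_def _ that]) (rule small)
  show ?thesis
  proof (cases "\<exists>m\<in>S. \<exists>m'\<in>S. \<not> (J1 m = J1 m' \<and> J2 m = J2 m')")
    case True
    then obtain m0 m0' where m0: "m0 \<in> S" "m0' \<in> S" "\<not> (J1 m0 = J1 m0' \<and> J2 m0 = J2 m0')" by blast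
    then have ww: "w1 = w2" "J1 m0 = J2 m0" "J1 m0' = J2 m0'" using cmp[OF m0] by simp_all
    have diag: "J1 m = J2 m" if "m \<in> S" for m
      using cmp[OF that m0(1)] ww(2) by blast
    have "e m0 = t" using ww by (simp add: e_def W1_def W2_def)
    then have ts: "8 * \<bar>t $ k\<bar> < 7 * ?b" for k using em[OF m0(1), of k] by simp
    have "vcong n (p2 n u) (p1 n (u + t))" if u: "\<And>k. \<bar>u $ k\<bar> \<le> 12 * ?M" for u
    proof -
      have u13: "\<bar>u $ k\<bar> \<le> 13 * ?M" for k using u[of k] Q by linarith
      have "u + t + \<tau>1 = u + \<tau>'" by (simp add: t_def)
      moreover have "vcong n (p1 n (u + t)) (u + t + \<tau>1 + W1 (J1 (vdiv n (u + t + \<tau>1))))"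
        using p1u[OF add13[OF u ts]] by blast
      ultimately have "vcong n (p1 n (u + t)) (u + \<tau>' + W1 (J1 (vdiv n (u + \<tau>'))))" by (simp only:)
      moreover have "W1 (J1 (vdiv n (u + \<tau>'))) = W2 (J2 (vdiv n (u + \<tau>')))"
        using diag p2u[OF u13] ww(1) by (simp add: W1_def W2_def)
      ultimately have "vcong n (p1 n (u + t)) (u + \<tau>' + W2 (J2 (vdiv n (u + \<tau>'))))" by simp
      then show ?thesis using p2u[OF u13] vcong_sym vcong_trans by blast
    qed
    then show ?thesis using ts by blast
  next
    case False
    define m0 where "m0 = vdiv n (0 + \<tau>1)"
    have m0: "m0 \<in> S" using p1u[of 0] Q by (simp add: m0_def)
    have const: "J1 m = J1 m0 \<and> J2 m = J2 m0" if "m \<in> S" for m using False that m0 by blast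
    have "vcong n (p2 n u) (p1 n (u + e m0))" if u: "\<And>k. \<bar>u $ k\<bar> \<le> 12 * ?M" for u
    proof -
      have u13: "\<bar>u $ k\<bar> \<le> 13 * ?M" for k using u[of k] Q by linarith
      have "vcong n (p1 n (u + e m0)) (u + e m0 + \<tau>1 + W1 (J1 m0))"
        using p1u[OF add13[OF u em[OF m0]]] const by auto
      moreover have "u + e m0 + \<tau>1 + W1 (J1 m0) = u + \<tau>' + W2 (J2 m0)" by (simp add: e_def t_def)
      moreover have "vcong n (p2 n u) (u + \<tau>' + W2 (J2 m0))" using p2u[OF u13] const by auto
      ultimately show ?thesis using vcong_sym vcong_trans by fastforce
    qed
    then show ?thesis using em[OF m0] by blast
  qed
qed

text \<open>On an untorn cube the translations of two consecutive levels are congruent modulo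
  \<open>q (Suc n)\<close>, and both are too small to differ by a nonzero multiple. So they are
  constant from level \<open>N\<close> on.\<close>

lemma rigid:
  fixes p1 p2 :: "nat \<Rightarrow> int ^ 'd \<Rightarrow> int ^ 'd"
  assumes p: "phases p1" "phases p2" and ex: "\<And>n \<sigma>. N \<le> n \<Longrightarrow> narrow p1 p2 n \<sigma> \<Longrightarrow> near0 n \<sigma>"
  shows "\<exists>\<rho>. \<forall>n u. vcong n (p2 n u) (p1 n (u + \<rho>))"
proof -
  have "\<forall>n. N \<le> n \<longrightarrow> (\<exists>\<rho>. (\<forall>k. 8 * \<bar>\<rho> $ k\<bar> < 7 * q n) \<and>
    (\<forall>u. (\<forall>k. \<bar>u $ k\<bar> \<le> 12 * q (Suc n)) \<longrightarrow> vcong n (p2 n u) (p1 n (u + \<rho>))))"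
    using rigid_level[OF p] ex by blast
  then obtain \<rho> where rb: "\<And>n k. N \<le> n \<Longrightarrow> 8 * \<bar>\<rho> n $ k\<bar> < 7 * q n"
    and r: "\<And>n u. N \<le> n \<Longrightarrow> (\<And>k. \<bar>u $ k\<bar> \<le> 12 * q (Suc n)) \<Longrightarrow> vcong n (p2 n u) (p1 n (u + \<rho> n))"
    by metis
  have eq: "\<rho> (Suc n) = \<rho> n" if n: "N \<le> n" for n
  proof -
    let ?b = "q n" let ?M = "q (Suc n)"
    have Q: "0 < ?b" "?M = 8193 * ?b" by (auto simp: q_pos q_Suc)
    have "0 \<le> 2 * ?M" "3 * (2 * ?M) \<le> 32 * ?M" using Q by simp_all
    then obtain b \<tau> where b: "cube b (2 * ?M) \<subseteq> cube (\<chi> k. - 3 * ?M) (3 * (2 * ?M))"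
       "\<And>u. u \<in> cube b (2 * ?M) \<Longrightarrow> vcong n (p1 n u) (u + \<tau>)"
      using untorn_cube[OF p(1)] by blast
    have "b \<in> cube b (2 * ?M)" using Q by (simp add: cube_def)
    then have "b \<in> cube (\<chi> k. - 3 * ?M) (3 * (2 * ?M))" using b(1) by blast
    then have bb: "- 3 * ?M \<le> b $ k \<and> b $ k < 3 * ?M" for k by (auto simp: cube_def dest: spec[of _ k])
    \<comment> \<open>\<open>u + \<rho> n\<close> is the centre of the untorn cube, so that
      \<open>u + \<rho> (Suc n)\<close> also lies in the cube.\<close>
    define u where "u = (\<chi> k. b $ k + ?M - \<rho> n $ k)"
    have r0: "8 * \<bar>\<rho> n $ k\<bar> < 7 * ?b" "8 * \<bar>\<rho> (Suc n) $ k\<bar> < 7 * ?M" for k using rb[of n k] rb[of "Suc n" k] n by auto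
    have r1: "\<bar>\<rho> n $ k\<bar> < ?b" for k using r0(1) by (rule lt_of_small)
    \<comment> \<open>Seven eighths of \<open>?M\<close> plus one \<open>?b\<close> stay below
      \<open>?M\<close>.\<close>
    have "\<bar>\<rho> (Suc n) $ k\<bar> + \<bar>\<rho> n $ k\<bar> < ?M" for k
      using r0(2)[of k] r1[of k] Q by linarith
    then have r2: "\<bar>\<rho> (Suc n) $ k - \<rho> n $ k\<bar> < ?M" for k by (meson abs_triangle_ineq4 le_less_trans)
    have u: "\<bar>u $ k\<bar> \<le> 12 * ?M" for k using bb[of k] r1[of k] Q unfolding u_def vec_lambda_beta by linarith
    have "u + \<rho> n \<in> cube b (2 * ?M)" "u + \<rho> (Suc n) \<in> cube b (2 * ?M)"
    proof -
      have "b $ k \<le> u $ k + \<rho> n $ k \<and> u $ k + \<rho> n $ k < b $ k + 2 * ?M \<and>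
        b $ k \<le> u $ k + \<rho> (Suc n) $ k \<and> u $ k + \<rho> (Suc n) $ k < b $ k + 2 * ?M" for k
        using r2[of k] Q unfolding u_def vec_lambda_beta by linarith
      then show "u + \<rho> n \<in> cube b (2 * ?M)" "u + \<rho> (Suc n) \<in> cube b (2 * ?M)" by (auto simp: cube_def)
    qed
    then have 1: "vcong n (p1 n (u + \<rho> n)) (u + \<rho> n + \<tau>)" "vcong n (p1 n (u + \<rho> (Suc n))) (u + \<rho> (Suc n) + \<tau>)"
      using b(2) by blast+
    have "vcong n (p2 n u) (p1 n (u + \<rho> n))" using r[OF n u] by simp
    moreover have "vcong n (p2 n u) (p1 n (u + \<rho> (Suc n)))"
    proof (rule phases_level[OF p(2,1)])
      have "\<bar>u $ k\<bar> \<le> 12 * q (Suc (Suc n))" for k using u[of k] q_mono[of "Suc n" "Suc (Suc n)"] by simp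
      then show "vcong (Suc n) (p2 (Suc n) u) (p1 (Suc n) (u + \<rho> (Suc n)))" using r[of "Suc n" u] n by simp
    qed simp
    ultimately have "vcong n (u + \<rho> (Suc n) + \<tau>) (u + \<rho> n + \<tau>)" using 1 vcong_sym vcong_trans by meson
    then have "?M dvd \<rho> (Suc n) $ k - \<rho> n $ k" for k by (auto simp: vcong_def cong_iff_dvd_diff)
    then have "\<rho> (Suc n) $ k - \<rho> n $ k = 0" for k
      using dvd_imp_le_int[of "\<rho> (Suc n) $ k - \<rho> n $ k" ?M] r2[of k]
      by (cases "\<rho> (Suc n) $ k - \<rho> n $ k = 0") auto
    then show ?thesis by (simp add: vec_eq_iff)
  qed
  have const: "\<rho> n = \<rho> N" if "N \<le> n" for n using that by (induction rule: dec_induct) (simp_all add: eq)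
  have "vcong n (p2 n u) (p1 n (u + \<rho> N))" for n u
  proof -
    have "finite {u}" by simp
    then obtain L where L: "max n N \<le> L" "\<forall>v\<in>{u}. \<forall>k. \<bar>v $ k\<bar> \<le> q (Suc L)" using ex_big_level by blast
    have "\<bar>u $ k\<bar> \<le> 12 * q (Suc L)" for k
    proof -
      have "\<bar>u $ k\<bar> \<le> q (Suc L)" using L(2) by simp
      then show ?thesis using q_pos[of "Suc L"] by linarith
    qed
    then have "vcong L (p2 L u) (p1 L (u + \<rho> L))" using r[of L u] L(1) by simp
    then have "vcong L (p2 L u) (p1 L (u + \<rho> N))" using const[of L] L(1) by simp
    then show ?thesis using phases_level[OF p(2,1)] L(1) by simp
  qed
  then show ?thesis by blast
qed

lemma pair_dichotomy:
  fixes p1 p2 :: "nat \<Rightarrow> int ^ 'd \<Rightarrow> int ^ 'd"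
  assumes p: "phases p1" "phases p2"
  shows "(\<exists>\<rho>. \<forall>n u. vcong n (p2 n u) (p1 n (u + \<rho>))) \<or>
    (\<forall>l R t1 t2. \<exists>g. \<forall>n\<le>l. \<forall>u. (\<forall>k. \<bar>u $ k\<bar> \<le> R) \<longrightarrow>
       vcong n (p1 n (u + g)) (base n (u + t1)) \<and> vcong n (p2 n (u + g)) (base n (u + t2)))"
proof (cases "\<exists>N. \<forall>n\<ge>N. \<forall>\<sigma>. narrow p1 p2 n \<sigma> \<longrightarrow> near0 n \<sigma>")
  case True
  then obtain N where "\<And>n \<sigma>. N \<le> n \<Longrightarrow> narrow p1 p2 n \<sigma> \<Longrightarrow> near0 n \<sigma>" by blast
  then show ?thesis using rigid[OF p] by blast
next
  case False
  then have "\<And>n0. \<exists>n\<ge>n0. \<exists>\<rho>. narrow p1 p2 n \<rho> \<and> \<not> near0 n \<rho>" by blast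
  from dense_pair[OF p this] show ?thesis by blast
qed

section \<open>Perfect sets of bit functions\<close>

lemma cylinder_open: "finite K \<Longrightarrow> open {f :: 'i \<Rightarrow> bool. \<forall>i\<in>K. f i = x i}"
  using product_topology_basis'[of K "\<lambda>i. {x i}" "\<lambda>i. i"] by (simp add: open_discrete)

lemma open_fun_cylinder:
  fixes U :: "('i \<Rightarrow> bool) set"
  assumes "open U" "x \<in> U"
  shows "\<exists>K. finite K \<and> {f. \<forall>i\<in>K. f i = x i} \<subseteq> U"
proof -
  have "openin (product_topology (\<lambda>i. euclidean) UNIV) U" using assms(1) by (simp add: open_fun_def)
  from product_topology_open_contains_basis[OF this assms(2)]
  obtain X where X: "x \<in> (\<Pi>\<^sub>E i\<in>UNIV. X i)" "finite {i. X i \<noteq> UNIV}" "(\<Pi>\<^sub>E i\<in>UNIV. X i) \<subseteq> U" by auto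
  have "{f. \<forall>i\<in>{i. X i \<noteq> UNIV}. f i = x i} \<subseteq> (\<Pi>\<^sub>E i\<in>UNIV. X i)"
  proof
    fix f assume f: "f \<in> {f. \<forall>i\<in>{i. X i \<noteq> UNIV}. f i = x i}"
    have "f i \<in> X i" for i using f X(1) by (cases "X i = UNIV") (auto simp: PiE_iff)
    then show "f \<in> (\<Pi>\<^sub>E i\<in>UNIV. X i)" by auto
  qed
  from subset_trans[OF this X(3)] show ?thesis using X(2) by (intro exI conjI)
qed

lemma closure_fun_bool:
  "x \<in> closure (S :: ('i \<Rightarrow> bool) set) \<longleftrightarrow> (\<forall>K. finite K \<longrightarrow> (\<exists>y\<in>S. \<forall>i\<in>K. y i = x i))"
proof
  assume x: "x \<in> closure S"
  show "\<forall>K. finite K \<longrightarrow> (\<exists>y\<in>S. \<forall>i\<in>K. y i = x i)"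
  proof (intro allI impI)
    fix K :: "'i set" assume "finite K"
    then have "open {f. \<forall>i\<in>K. f i = x i}" by (rule cylinder_open)
    then show "\<exists>y\<in>S. \<forall>i\<in>K. y i = x i" using open_Int_closure_eq_empty[of "{f. \<forall>i\<in>K. f i = x i}" S] x by blast
  qed
next
  assume r: "\<forall>K. finite K \<longrightarrow> (\<exists>y\<in>S. \<forall>i\<in>K. y i = x i)"
  show "x \<in> closure S"
  proof (rule ccontr)
    assume "x \<notin> closure S"
    then obtain K where "finite K" "{f. \<forall>i\<in>K. f i = x i} \<subseteq> - closure S"
      using open_fun_cylinder[of "- closure S" x] by auto
    then show False using r closure_subset[of S] by blast
  qed
qed

lemma compact_UNIV_fun_bool: "compact (UNIV :: ('i \<Rightarrow> bool) set)"
proof -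
  have "compact (UNIV :: bool set)" by (simp add: finite_imp_compact)
  then have "compact_space (euclidean :: bool topology)" by (simp add: compact_space_def)
  then have "compact_space (product_topology (\<lambda>i::'i. euclidean :: bool topology) UNIV)"
    by (simp add: compact_space_product_topology)
  then show ?thesis by (simp add: euclidean_product_topology compact_space_def)
qed

lemma continuous_on_locally_const:
  fixes f :: "'a::topological_space \<Rightarrow> 'b::topological_space"
  assumes "\<And>x. x \<in> X \<Longrightarrow> \<exists>U. open U \<and> x \<in> U \<and> (\<forall>y\<in>X \<inter> U. f y = f x)"
  shows "continuous_on X f"
  unfolding continuous_on_topological using assms by (metis IntI)

section \<open>Bit sequences and ternary expansions\<close>

definition ternary :: "(nat \<Rightarrow> bool) \<Rightarrow> real" where
  "ternary b = (\<Sum>n. (if b n then 2 else 0) / 3 ^ Suc n)"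

lemma summable_23: "summable (\<lambda>n. 2 / 3 ^ Suc n :: real)" and suminf_23: "(\<Sum>n. 2 / 3 ^ Suc n :: real) = 1"
proof -
  have e: "(\<lambda>n. 2 / 3 ^ Suc n :: real) = (\<lambda>n. (2/3) * (1/3) ^ n)" by (auto simp: power_divide)
  show "summable (\<lambda>n. 2 / 3 ^ Suc n :: real)" unfolding e by (intro summable_mult summable_geometric) simp
  show "(\<Sum>n. 2 / 3 ^ Suc n :: real) = 1" unfolding e by (subst suminf_mult) (auto simp: suminf_geometric)
qed

lemma summable_ternary: "summable (\<lambda>n. (if b n then 2 else 0) / 3 ^ Suc n :: real)"
  by (rule summable_comparison_test'[OF summable_23, of 0]) auto

lemma ternary_bounds: "0 \<le> ternary b" "ternary b \<le> 1"
proof -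
  show "0 \<le> ternary b" unfolding ternary_def by (rule suminf_nonneg[OF summable_ternary]) auto
  have "ternary b \<le> (\<Sum>n. 2 / 3 ^ Suc n)"
    unfolding ternary_def by (rule suminf_le[OF _ summable_ternary summable_23]) auto
  then show "ternary b \<le> 1" by (simp only: suminf_23)
qed

lemma ternary_head: "ternary b = (if b 0 then 2 else 0) / 3 + ternary (\<lambda>n. b (Suc n)) / 3"
proof -
  have "ternary (\<lambda>n. b (Suc n)) / 3 = (\<Sum>n. (if b (Suc n) then 2 else 0) / 3 ^ Suc n / 3)"
    unfolding ternary_def by (rule suminf_divide[OF summable_ternary, symmetric])
  also have "\<dots> = (\<Sum>n. (if b (Suc n) then 2 else 0) / 3 ^ Suc (Suc n))" by (simp add: mult.commute)
  also have "\<dots> = ternary b - (if b 0 then 2 else 0) / 3"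
    using suminf_split_head[OF summable_ternary[of b]] by (simp add: ternary_def)
  finally show ?thesis by (simp add: field_simps)
qed

text \<open>Values with first bit 0 lie in the interval from 0 to 1/3, those with first bit 1 in
  that from 2/3 to 1. So the first bit can be read off, and the tails are compared
  inductively.\<close>

lemma ternary_inj: "ternary b = ternary c \<Longrightarrow> b n = c n"
proof (induction n arbitrary: b c)
  case 0
  then show ?case
    using ternary_head[of b] ternary_head[of c] ternary_bounds[of "\<lambda>n. b (Suc n)"] ternary_bounds[of "\<lambda>n. c (Suc n)"]
    by (cases "b 0"; cases "c 0") auto
next
  case (Suc n)
  have "b 0 = c 0"
    using Suc.prems ternary_head[of b] ternary_head[of c] ternary_bounds[of "\<lambda>n. b (Suc n)"] ternary_bounds[of "\<lambda>n. c (Suc n)"]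
    by (cases "b 0"; cases "c 0") auto
  then have "ternary (\<lambda>n. b (Suc n)) = ternary (\<lambda>n. c (Suc n))"
    using Suc.prems ternary_head[of b] ternary_head[of c] by simp
  from Suc.IH[OF this] show ?case .
qed

lemma range_ternary: "range ternary = cantor_set"
proof
  show "range ternary \<subseteq> cantor_set"
  proof
    fix x assume "x \<in> range ternary"
    then obtain b where "x = ternary b" by blast
    then have "(\<lambda>n. (if b n then 2 else 0) / 3 ^ Suc n) sums x"
      using summable_sums[OF summable_ternary[of b]] by (simp add: ternary_def)
    then show "x \<in> cantor_set" unfolding cantor_set_def
      by (intro CollectI exI[of _ "\<lambda>n. if b n then 2 else 0"]) auto
  qed
  show "cantor_set \<subseteq> range ternary"
  proof
    fix x assume "x \<in> cantor_set"
    then obtain a :: "nat \<Rightarrow> real" where a: "\<And>n. a n \<in> {0, 2}" "(\<lambda>n. a n / 3 ^ Suc n) sums x"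
      unfolding cantor_set_def by blast
    have "(if a n = 2 then 2 else 0) = a n" for n using a(1)[of n] by auto
    then have "ternary (\<lambda>n. a n = 2) = x" unfolding ternary_def using sums_unique[OF a(2)] by simp
    then show "x \<in> range ternary" by blast
  qed
qed

lemma continuous_ternary: "continuous_on UNIV ternary"
proof -
  have "uniform_limit UNIV (\<lambda>n b. \<Sum>i<n. (if b i then 2 else 0) / 3 ^ Suc i)
      (\<lambda>b. \<Sum>i. (if b i then 2 else 0) / 3 ^ Suc i :: real) sequentially"
    by (rule Weierstrass_m_test[OF _ summable_23]) auto
  moreover have "continuous_on UNIV (\<lambda>b :: nat \<Rightarrow> bool. \<Sum>i<n. (if b i then 2 else 0) / 3 ^ Suc i :: real)" for n
  proof (rule continuous_on_locally_const)
    fix x :: "nat \<Rightarrow> bool"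
    show "\<exists>U. open U \<and> x \<in> U \<and> (\<forall>y\<in>UNIV \<inter> U. (\<Sum>i<n. (if y i then 2 else 0) / 3 ^ Suc i :: real) =
        (\<Sum>i<n. (if x i then 2 else 0) / 3 ^ Suc i))"
      by (rule exI[of _ "{f. \<forall>i\<in>{..<n}. f i = x i}"]) (auto simp: cylinder_open intro!: sum.cong)
  qed
  ultimately have "continuous_on UNIV (\<lambda>b. \<Sum>i. (if b i then 2 else 0) / 3 ^ Suc i :: real)"
    by (intro uniform_limit_theorem[where F = sequentially]) auto
  then show ?thesis by (simp add: ternary_def[abs_def])
qed

lemma ex_rank:
  fixes S :: "nat set"
  assumes "infinite S"
  shows "\<exists>m\<in>S. card (S \<inter> {..<m}) = k"
proof (induction k)
  case 0
  have ne: "S \<noteq> {}" using assms by auto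
  define m where "m = (LEAST m. m \<in> S)"
  have "m \<in> S" "\<And>i. i \<in> S \<Longrightarrow> m \<le> i" unfolding m_def using ne by (auto intro: LeastI Least_le)
  then have "S \<inter> {..<m} = {}" by fastforce
  then show ?case using \<open>m \<in> S\<close> by (intro bexI[of _ m]) simp_all
next
  case (Suc k)
  then obtain m where m: "m \<in> S" "card (S \<inter> {..<m}) = k" by blast
  have "infinite (S \<inter> {m<..})"
  proof
    assume "finite (S \<inter> {m<..})"
    then have "finite (S \<inter> {m<..} \<union> {..m})" by simp
    then show False using assms finite_subset[of S "S \<inter> {m<..} \<union> {..m}"] by force
  qed
  then have ne: "\<exists>i. i \<in> S \<inter> {m<..}" using infinite_imp_nonempty by blast
  define j where "j = (LEAST i. i \<in> S \<inter> {m<..})"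
  have j: "j \<in> S \<inter> {m<..}" "\<And>i. i \<in> S \<inter> {m<..} \<Longrightarrow> j \<le> i" 
    unfolding j_def using LeastI_ex[OF ne] by (auto intro: Least_le)
  have "i = m \<or> i < m" if "i \<in> S" "i < j" for i using j(2)[of i] that by fastforce
  then have "S \<inter> {..<j} = insert m (S \<inter> {..<m})" using m(1) j(1) by auto
  then show ?case using m j(1) by (intro bexI[of _ j]) auto
qed

lemma rank_less:
  fixes S :: "nat set"
  assumes "m \<in> S" "m < m'"
  shows "card (S \<inter> {..<m}) < card (S \<inter> {..<m'})"
  using assms by (intro psubset_card_mono) auto

text \<open>A point of a perfect set of bit sequences is determined by its bits at the indices where the set
  branches along it, and these bits are arbitrary.\<close>

theorem perfect_bits_homeomorphic:
  fixes X :: "(nat \<Rightarrow> bool) set"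
  assumes X: "compact X" "X \<noteq> {}" and perfect: "\<And>x N. x \<in> X \<Longrightarrow> \<exists>y\<in>X. y \<noteq> x \<and> (\<forall>i<N. y i = x i)"
  shows "\<exists>\<phi> \<psi>. homeomorphism X cantor_set \<phi> \<psi>"
proof -
  \<comment> \<open>The indices at which \<open>X\<close> branches along \<open>x\<close>: the bits
    before \<open>n\<close> do not determine the bit \<open>n\<close> within
    \<open>X\<close>.\<close>
  define B where "B x = {n. \<exists>y\<in>X. (\<forall>i<n. y i = x i) \<and> y n \<noteq> x n}" for x
  have first_diff: "\<exists>n. (\<forall>i<n. y i = x i) \<and> y n \<noteq> x n" if "y \<noteq> x" for x y :: "nat \<Rightarrow> bool"
  proof -
    have "\<exists>n. y n \<noteq> x n" using that by auto
    then show ?thesis using exists_least_iff[of "\<lambda>n. y n \<noteq> x n"] by auto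
  qed
  have inf: "infinite (B x)" if "x \<in> X" for x
    unfolding infinite_nat_iff_unbounded_le
  proof
    fix N
    obtain y where y: "y \<in> X" "y \<noteq> x" "\<forall>i<N. y i = x i" using perfect[OF \<open>x \<in> X\<close>] by blast
    obtain n where n: "\<forall>i<n. y i = x i" "y n \<noteq> x n" using first_diff[OF y(2)] by blast
    then have "N \<le> n" using y(3) by (meson linorder_not_less)
    then show "\<exists>n\<ge>N. n \<in> B x" using n y(1) unfolding B_def by blast
  qed
  have B_agree: "n \<in> B x \<longleftrightarrow> n \<in> B y" if "\<forall>i\<le>n. y i = x i" for x y n
    unfolding B_def using that by auto
  \<comment> \<open>The branching index of rank \<open>k\<close>, counted from 0.\<close>
  define pos where "pos x k = (SOME m. m \<in> B x \<and> card (B x \<inter> {..<m}) = k)" for x k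
  have pos: "pos x k \<in> B x" "card (B x \<inter> {..<pos x k}) = k" if "x \<in> X" for x k
  proof -
    have "\<exists>m. m \<in> B x \<and> card (B x \<inter> {..<m}) = k" using ex_rank[OF inf[OF that], of k] by blast
    then show "pos x k \<in> B x" "card (B x \<inter> {..<pos x k}) = k"
      unfolding pos_def using someI_ex[of "\<lambda>m. m \<in> B x \<and> card (B x \<inter> {..<m}) = k"] by blast+
  qed
  have pos_eq: "pos x k = m" if "x \<in> X" "m \<in> B x" "card (B x \<inter> {..<m}) = k" for x m k
    using pos[OF that(1), of k] rank_less[of m "B x" "pos x k"] rank_less[of "pos x k" "B x" m] that
    by (metis linorder_neq_iff)
  define h where "h x k = x (pos x k)" for x k
  \<comment> \<open>Branching at an index depends only on the bits before it, so points agreeing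
    below \<open>m\<close> have the same branching indices up to \<open>m\<close>. If they differ at
    \<open>m\<close>, each one witnesses the branching of the other.\<close>
  have trans: "pos y k = m" if "x \<in> X" "y \<in> X" "m \<in> B x" "card (B x \<inter> {..<m}) = k" "\<forall>i<m. y i = x i" for x y m k
  proof (rule pos_eq[OF that(2)])
    have "B y \<inter> {..<m} = B x \<inter> {..<m}" using B_agree[of _ y x] that(5) by force
    then show "card (B y \<inter> {..<m}) = k" using that(4) by simp
    show "m \<in> B y"
    proof (cases "y m = x m")
      case True
      then have "\<forall>i\<le>m. y i = x i" using that(5) by (metis le_neq_implies_less)
      then show ?thesis using B_agree that(3) by blast
    next
      case False
      then show ?thesis unfolding B_def using that(1,5) by (intro CollectI bexI[of _ x]) auto
    qed
  qed
  have inj: "inj_on h X"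
  proof (rule inj_onI, rule ccontr)
    fix x y assume xy: "x \<in> X" "y \<in> X" "h x = h y" "x \<noteq> y"
    obtain m where m: "\<forall>i<m. y i = x i" "y m \<noteq> x m" using first_diff[of y x] xy(4) by blast
    then have mB: "m \<in> B x" unfolding B_def using xy(2) by blast
    define k where "k = card (B x \<inter> {..<m})"
    have "pos x k = m" "pos y k = m" using pos_eq[OF xy(1) mB] trans[OF xy(1,2) mB _ m(1)] by (simp_all add: k_def)
    then show False using xy(3) m(2) by (metis h_def)
  qed
  have cont: "continuous_on X h"
  proof (rule continuous_on_coordinatewise_then_product, rule continuous_on_locally_const)
    fix k x assume x: "x \<in> X"
    let ?U = "{f. \<forall>i\<in>{..pos x k}. f i = x i}"
    have "h y k = h x k" if "y \<in> X \<inter> ?U" for y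
    proof -
      have "pos y k = pos x k" by (rule trans[OF x]) (use that pos[OF x] in auto)
      then show ?thesis using that by (simp add: h_def)
    qed
    then show "\<exists>U. open U \<and> x \<in> U \<and> (\<forall>y\<in>X \<inter> U. h y k = h x k)"
      by (intro exI[of _ ?U]) (auto simp: cylinder_open)
  qed
  \<comment> \<open>Switching the branching bit of rank \<open>k\<close> keeps all earlier bits, so
    a prefix can be prescribed one bit at a time.\<close>
  have dense: "\<exists>x\<in>X. \<forall>i<k. h x i = z i" for z k
  proof (induction k)
    case 0
    then show ?case using X(2) by auto
  next
    case (Suc k)
    then obtain x where x: "x \<in> X" "\<forall>i<k. h x i = z i" by blast
    show ?case
    proof (cases "h x k = z k")
      case True
      then show ?thesis using x by (intro bexI[of _ x]) (auto simp: less_Suc_eq)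
    next
      case False
      obtain y where y: "y \<in> X" "\<forall>i<pos x k. y i = x i" "y (pos x k) \<noteq> x (pos x k)"
        using pos(1)[OF x(1), of k] unfolding B_def by blast
      have "pos y k = pos x k" by (rule trans[OF x(1) y(1) _ _ y(2)]) (use pos[OF x(1)] in auto)
      then have "h y k = z k" using False y(3) by (auto simp: h_def)
      moreover have "h y i = h x i" if "i < k" for i
      proof -
        have "pos x i < pos x k"
          using rank_less[OF pos(1)[OF x(1), of k], of "pos x i"] pos(2)[OF x(1), of i] pos(2)[OF x(1), of k] that
          by (metis linorder_neqE_nat not_less_iff_gr_or_eq)
        then have "\<forall>j<pos x i. y j = x j" "y (pos x i) = x (pos x i)" using y(2) by auto
        then show ?thesis using trans[OF x(1) y(1) pos(1)[OF x(1)] pos(2)[OF x(1)], of i] by (simp add: h_def)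
      qed
      ultimately show ?thesis using y(1) x(2) by (intro bexI[of _ y]) (auto simp: less_Suc_eq)
    qed
  qed
  define f where "f x = ternary (h x)" for x
  have contf: "continuous_on X f"
    unfolding f_def by (rule continuous_on_compose2[OF continuous_ternary cont]) simp
  \<comment> \<open>The image of \<open>h\<close> is dense. As \<open>X\<close> is compact, its
    image under \<open>f\<close> is closed, hence all of \<open>cantor_set\<close>.\<close>
  have "z \<in> closure (h ` X)" for z
    unfolding closure_fun_bool
  proof (intro allI impI)
    fix K :: "nat set" assume "finite K"
    then obtain k where "K \<subseteq> {..<k}" using finite_nat_iff_bounded by blast
    then show "\<exists>y\<in>h ` X. \<forall>i\<in>K. y i = z i" using dense[of k z] by auto
  qed
  then have "closure (h ` X) = UNIV" by blast
  moreover have "ternary ` closure (h ` X) \<subseteq> closure (ternary ` h ` X)"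
    by (rule image_closure_subset[OF continuous_on_subset[OF continuous_ternary]]) (simp_all add: closure_subset)
  ultimately have "ternary ` UNIV \<subseteq> closure (ternary ` h ` X)" by simp
  also have "ternary ` h ` X = f ` X" by (auto simp: f_def)
  also have "closure (f ` X) = f ` X"
    using compact_continuous_image[OF contf X(1)] by (simp add: compact_imp_closed)
  finally have "f ` X = cantor_set" using range_ternary by (auto simp: f_def)
  moreover have "inj_on f X"
  proof (rule inj_onI)
    fix x y assume "x \<in> X" "y \<in> X" "f x = f y"
    moreover from this have "h x = h y" unfolding f_def by (intro ext ternary_inj)
    ultimately show "x = y" using inj by (simp add: inj_on_eq_iff)
  qed
  ultimately show ?thesis using homeomorphism_compact[OF X(1) contf] by blast
qed

theorem perfect_fun_bool_homeomorphic:
  fixes X :: "('i::countable \<Rightarrow> bool) set"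
  assumes X: "closed X" "X \<noteq> {}"
    and perfect: "\<And>x K. x \<in> X \<Longrightarrow> finite K \<Longrightarrow> \<exists>y\<in>X. y \<noteq> x \<and> (\<forall>i\<in>K. y i = x i)"
  shows "\<exists>\<phi> \<psi>. homeomorphism X cantor_set \<phi> \<psi>"
proof -
  \<comment> \<open>\<open>from_nat\<close> may list a coordinate several times, but it lists every
    coordinate, so \<open>e\<close> is injective.\<close>
  define e :: "('i \<Rightarrow> bool) \<Rightarrow> nat \<Rightarrow> bool" where "e x = (\<lambda>n. x (from_nat n))" for x
  have e_to_nat: "e x (to_nat i) = x i" for x i by (simp add: e_def)
  have inj: "inj e" 
  proof (rule injI)
    fix x y assume "e x = e y"
    then have "x i = y i" for i using e_to_nat by metis
    then show "x = y" by (rule ext)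
  qed
  have compact: "compact X" using closed_Int_compact[OF X(1) compact_UNIV_fun_bool] by simp
  have cont: "continuous_on X e"
    unfolding e_def
    by (intro continuous_on_coordinatewise_then_product continuous_on_subset[OF continuous_on_product_coordinates]) simp
  have "\<exists>\<phi> \<psi>. homeomorphism (e ` X) cantor_set \<phi> \<psi>"
  proof (rule perfect_bits_homeomorphic)
    show "compact (e ` X)" using compact_continuous_image[OF cont compact] .
    show "e ` X \<noteq> {}" using X(2) by simp
    fix x N assume "x \<in> e ` X"
    then obtain x' where x': "x' \<in> X" "x = e x'" by blast
    obtain y where y: "y \<in> X" "y \<noteq> x'" "\<forall>i\<in>from_nat ` {..<N}. y i = x' i"
      using perfect[OF x'(1), of "from_nat ` {..<N}"] by auto
    have "e y \<noteq> x" using y(2) x'(2) inj by (simp add: inj_eq)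
    moreover have "\<forall>i<N. e y i = x i" using y(3) x'(2) by (simp add: e_def)
    ultimately show "\<exists>y\<in>e ` X. y \<noteq> x \<and> (\<forall>i<N. y i = x i)" using y(1) by blast
  qed
  then obtain \<phi> \<psi> where h: "homeomorphism (e ` X) cantor_set \<phi> \<psi>" by blast
  have "continuous_on X (\<phi> \<circ> e)"
    using h by (intro continuous_on_compose[OF cont]) (simp add: homeomorphism_def)
  moreover have "(\<phi> \<circ> e) ` X = cantor_set" using h by (auto simp: homeomorphism_def image_comp)
  moreover have "inj_on (\<phi> \<circ> e) X"
  proof (rule comp_inj_on)
    show "inj_on e X" using inj by (rule inj_on_subset) simp
    show "inj_on \<phi> (e ` X)" by (rule inj_on_inverseI[of _ \<psi>]) (use h in \<open>auto simp: homeomorphism_def\<close>)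
  qed
  ultimately show ?thesis using homeomorphism_compact[OF compact] by blast
qed

section \<open>The action on the Cantor set\<close>

text \<open>Recording the outcome of every congruence test, rather than a residue, places all levels
  in one product of two-point spaces and identifies phase functions that are congruent.\<close>

definition bits :: "(nat \<Rightarrow> int ^ 'd \<Rightarrow> int ^ 'd) \<Rightarrow> nat \<times> (int ^ 'd) \<times> (int ^ 'd) \<Rightarrow> bool" where
  "bits p = (\<lambda>(n, u, \<theta>). vcong n (p n u) \<theta>)"

definition phase_space :: "(nat \<times> (int ^ 'd) \<times> (int ^ 'd) \<Rightarrow> bool) set" where
  "phase_space = closure (range (\<lambda>t. bits (\<lambda>n u. base n (u + t))))"

definition translate :: "int ^ 'd \<Rightarrow> (nat \<times> (int ^ 'd) \<times> (int ^ 'd) \<Rightarrow> bool) \<Rightarrow> nat \<times> (int ^ 'd) \<times> (int ^ 'd) \<Rightarrow> bool" where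
  "translate g x = (\<lambda>(n, u, \<theta>). x (n, u + g, \<theta>))"

lemma translate_bits: "translate g (bits p) = bits (\<lambda>n u. p n (u + g))"
  by (auto simp: translate_def bits_def)

lemma translate_add: "translate g (translate h x) = translate (g + h) x"
  by (auto simp: translate_def add.assoc)

lemma translate_0: "translate 0 x = x"
  by (auto simp: translate_def)

lemma bits_eq: "bits p = bits r \<longleftrightarrow> (\<forall>n u. vcong n (p n u) (r n u))"
proof
  assume e: "bits p = bits r"
  show "\<forall>n u. vcong n (p n u) (r n u)"
  proof (intro allI)
    fix n u
    have "bits r (n, u, r n u)" by (simp add: bits_def)
    then have "bits p (n, u, r n u)" using e by simp
    then show "vcong n (p n u) (r n u)" by (simp add: bits_def)
  qed
next
  assume r: "\<forall>n u. vcong n (p n u) (r n u)"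
  have "vcong n (p n u) \<theta> \<longleftrightarrow> vcong n (r n u) \<theta>" for n u \<theta>
    using r vcong_sym vcong_trans by blast
  then show "bits p = bits r" by (auto simp: bits_def)
qed

lemma finite_window:
  assumes "finite (K :: (nat \<times> (int ^ 'd) \<times> (int ^ 'd)) set)"
  shows "\<exists>N R. \<forall>n u \<theta>. (n, u, \<theta>) \<in> K \<longrightarrow> n \<le> N \<and> (\<forall>k. \<bar>u $ k\<bar> \<le> R)"
proof -
  obtain N where N: "\<forall>n\<in>fst ` K. n \<le> N" using assms finite_nat_set_iff_bounded_le by blast
  have "finite ((fst \<circ> snd) ` K)" using assms by simp
  then obtain R where R: "\<forall>u\<in>(fst \<circ> snd) ` K. \<forall>k. \<bar>u $ k\<bar> \<le> R" using ex_bound_finite by blast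
  have "n \<le> N \<and> (\<forall>k. \<bar>u $ k\<bar> \<le> R)" if "(n, u, \<theta>) \<in> K" for n u \<theta>
  proof -
    have "n \<in> fst ` K" "u \<in> (fst \<circ> snd) ` K" using that by force+
    then show ?thesis using N R by blast
  qed
  then show ?thesis by blast
qed

lemma bits_agree:
  assumes "\<And>n u \<theta>. (n, u, \<theta>) \<in> K \<Longrightarrow> vcong n (p n u) (r n u)"
  shows "\<forall>i\<in>K. bits p i = bits r i"
proof
  fix i assume "i \<in> K"
  moreover obtain n u \<theta> where i: "i = (n, u, \<theta>)" by (cases i) auto
  ultimately have "vcong n (p n u) (r n u)" using assms by blast
  then have "vcong n (p n u) \<theta> \<longleftrightarrow> vcong n (r n u) \<theta>" using vcong_sym vcong_trans by blast
  then show "bits p i = bits r i" by (simp add: bits_def i)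
qed

lemma bits_in_phase_space:
  assumes "phases p" shows "bits p \<in> phase_space"
  unfolding phase_space_def closure_fun_bool
proof (intro allI impI)
  fix K :: "(nat \<times> (int ^ 'a) \<times> (int ^ 'a)) set" assume "finite K"
  then obtain N R where K: "\<And>n u \<theta>. (n, u, \<theta>) \<in> K \<Longrightarrow> n \<le> N \<and> (\<forall>k. \<bar>u $ k\<bar> \<le> R)"
    using finite_window by blast
  obtain t where t: "\<And>n u. n \<le> N \<Longrightarrow> (\<And>k. \<bar>u $ k\<bar> \<le> R) \<Longrightarrow> vcong n (p n u) (base n (u + t))"
    using phasesE[OF assms] by blast
  have "\<forall>i\<in>K. bits (\<lambda>n u. base n (u + t)) i = bits p i"
    by (rule bits_agree, rule vcong_sym, rule t) (use K in auto)
  then show "\<exists>y\<in>range (\<lambda>t. bits (\<lambda>n u. base n (u + t))). \<forall>i\<in>K. y i = bits p i" by blast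
qed

lemma phase_space_approx:
  assumes "x \<in> phase_space" "finite K"
  shows "\<exists>t. \<forall>i\<in>K. x i = bits (\<lambda>n u. base n (u + t)) i"
proof -
  have "\<exists>y\<in>range (\<lambda>t. bits (\<lambda>n u. base n (u + t))). \<forall>i\<in>K. y i = x i"
    using assms unfolding phase_space_def closure_fun_bool by blast
  then show ?thesis by auto
qed

text \<open>Finitely many \<open>\<theta>\<close> represent all residues at level \<open>n\<close>,
  so that one of the tests at \<open>(n, u)\<close> succeeds is a condition on finitely many bits
  and passes to the closure. Choosing a successful test recovers the phase.\<close>

lemma phase_spaceD:
  fixes x :: "nat \<times> (int ^ 'd) \<times> (int ^ 'd) \<Rightarrow> bool"
  assumes "x \<in> phase_space"
  shows "\<exists>p. phases p \<and> x = bits p"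
proof -
  have ex: "\<exists>\<theta>. x (n, u, \<theta>)" for n u
  proof -
    let ?K = "(\<lambda>\<theta>. (n, u, \<theta>)) ` {\<theta>. \<forall>k. \<bar>\<theta> $ k\<bar> \<le> q (Suc n)}"
    have "finite ?K" by (intro finite_imageI finite_box)
    then obtain t where t: "\<forall>i\<in>?K. x i = bits (\<lambda>n u. base n (u + t)) i" using phase_space_approx[OF assms] by blast
    define \<theta> where "\<theta> = (\<chi> k. base n (u + t) $ k mod q (Suc n))"
    have "\<forall>k. \<bar>\<theta> $ k\<bar> \<le> q (Suc n)" using q_pos[of "Suc n"] by (simp add: \<theta>_def less_imp_le)
    then have "x (n, u, \<theta>) = bits (\<lambda>n u. base n (u + t)) (n, u, \<theta>)" using t by blast
    moreover have "vcong n (base n (u + t)) \<theta>" by (simp add: vcong_def \<theta>_def cong_def)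
    ultimately show ?thesis by (auto simp: bits_def)
  qed
  define p where "p n u = (SOME \<theta>. x (n, u, \<theta>))" for n u
  have xp: "x (n, u, p n u)" for n u unfolding p_def using ex by (rule someI_ex)
  have "x (n, u, \<theta>) \<longleftrightarrow> vcong n (p n u) \<theta>" for n u \<theta>
  proof -
    obtain t where t: "\<forall>i\<in>{(n, u, p n u), (n, u, \<theta>)}. x i = bits (\<lambda>n u. base n (u + t)) i"
      using phase_space_approx[OF assms, of "{(n, u, p n u), (n, u, \<theta>)}"] by auto
    then have "vcong n (base n (u + t)) (p n u)" "x (n, u, \<theta>) = vcong n (base n (u + t)) \<theta>"
      using xp[of n u] by (simp_all add: bits_def)
    then show ?thesis using vcong_sym vcong_trans by blast
  qed
  then have "x = bits p" by (auto simp: bits_def)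
  moreover have "phases p" unfolding phases_def
  proof (intro allI)
    fix N R
    let ?K = "(\<lambda>(n, u). (n, u, p n u)) ` ({..N} \<times> {u. \<forall>k. \<bar>u $ k\<bar> \<le> R})"
    have "finite ?K" by (intro finite_imageI finite_cartesian_product finite_box) simp
    then obtain t where t: "\<forall>i\<in>?K. x i = bits (\<lambda>n u. base n (u + t)) i" using phase_space_approx[OF assms] by blast
    have "vcong n (p n u) (base n (u + t))" if "n \<le> N" "\<forall>k. \<bar>u $ k\<bar> \<le> R" for n u
    proof -
      have "(n, u, p n u) \<in> ?K" using that by force
      then have "bits (\<lambda>n u. base n (u + t)) (n, u, p n u)" using t xp[of n u] by blast
      then show ?thesis by (simp add: bits_def vcong_sym)
    qed
    then show "\<exists>t. \<forall>n\<le>N. \<forall>u. (\<forall>k. \<bar>u $ k\<bar> \<le> R) \<longrightarrow> vcong n (p n u) (base n (u + t))" by blast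
  qed
  ultimately show ?thesis by blast
qed

lemma phase_space_iff: "x \<in> phase_space \<longleftrightarrow> (\<exists>p. phases p \<and> x = bits p)"
  using phase_spaceD bits_in_phase_space by blast

lemma translate_phase_space: "x \<in> phase_space \<Longrightarrow> translate g x \<in> phase_space"
  unfolding phase_space_iff using translate_bits phases_shift by metis

text \<open>Recurrence supplies a nontrivial translate that agrees on \<open>K\<close>, and freeness
  distinguishes it from \<open>x\<close>.\<close>

lemma phase_space_perfect:
  fixes x :: "nat \<times> (int ^ 'd) \<times> (int ^ 'd) \<Rightarrow> bool"
  assumes "x \<in> phase_space" "finite K"
  shows "\<exists>y\<in>phase_space. y \<noteq> x \<and> (\<forall>i\<in>K. y i = x i)"
proof -
  obtain p where p: "phases p" "x = bits p" using phase_spaceD[OF assms(1)] by blast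
  obtain N R where K: "\<And>n u \<theta>. (n, u, \<theta>) \<in> K \<Longrightarrow> n \<le> N \<and> (\<forall>k. \<bar>u $ k\<bar> \<le> R)"
    using finite_window[OF assms(2)] by blast
  obtain g where g: "g \<noteq> 0" "\<forall>n\<le>N. \<forall>u. (\<forall>k. \<bar>u $ k\<bar> \<le> R) \<longrightarrow> vcong n (p n (u + g)) (p n u)"
    using recurrence[OF p(1)] by blast
  have "\<forall>i\<in>K. bits (\<lambda>n u. p n (u + g)) i = bits p i"
    by (rule bits_agree) (use K g(2) in blast)
  moreover have "bits (\<lambda>n u. p n (u + g)) \<noteq> bits p"
    using phases_free[OF p(1) g(1)] by (simp add: bits_eq)
  ultimately show ?thesis using bits_in_phase_space[OF phases_shift[OF p(1)]] p(2) by blast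
qed

lemma continuous_translate: "continuous_on X (translate g)"
proof (rule continuous_on_coordinatewise_then_product)
  fix i :: "nat \<times> (int ^ 'a) \<times> (int ^ 'a)"
  obtain n u \<theta> where "i = (n, u, \<theta>)" by (cases i) auto
  then have "(\<lambda>x. translate g x i) = (\<lambda>x. x (n, u + g, \<theta>))" by (simp add: translate_def)
  then show "continuous_on X (\<lambda>x. translate g x i)"
    using continuous_on_subset[OF continuous_on_product_coordinates subset_UNIV] by metis
qed

lemma homeomorphism_translate:
  "homeomorphism (phase_space :: (nat \<times> (int ^ 'd) \<times> (int ^ 'd) \<Rightarrow> bool) set) phase_space (translate g) (translate (- g))"
proof (rule homeomorphismI)
  show "translate g ` phase_space \<subseteq> phase_space" "translate (- g) ` phase_space \<subseteq> phase_space" using translate_phase_space by blast+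
qed (simp_all add: continuous_translate translate_add translate_0)

lemma infinite_cantor_set: "infinite cantor_set"
proof
  assume "finite cantor_set"
  then have "finite (range ternary)" by (simp add: range_ternary)
  moreover have "inj ternary" by (rule injI, rule ext) (rule ternary_inj)
  ultimately have "finite (UNIV :: (nat \<Rightarrow> bool) set)" by (rule finite_imageD)
  then have "finite (UNIV :: nat set)" by (rule finite_fun_UNIVD1) simp
  then show False by simp
qed

theorem theorem5p17:
  assumes "CARD('d::finite) \<ge> 2"
  shows "\<exists>T :: int ^ 'd \<Rightarrow> real \<Rightarrow> real.
           doubly_minimal T cantor_set \<and> faithful_action T cantor_set"
proof -
  let ?X = "phase_space :: (nat \<times> (int ^ 'd) \<times> (int ^ 'd) \<Rightarrow> bool) set"
  have ne: "?X \<noteq> {}" using bits_in_phase_space[OF phases_base] by blast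
  have closed: "closed ?X" by (simp add: phase_space_def)
  obtain \<phi> \<psi> where h: "homeomorphism ?X cantor_set \<phi> \<psi>"
    using perfect_fun_bool_homeomorphic[OF closed ne phase_space_perfect] by blast
  have \<phi>\<psi>: "\<phi> (\<psi> z) = z" "\<psi> z \<in> ?X" if "z \<in> cantor_set" for z
    using h that by (auto simp: homeomorphism_def)
  have \<psi>\<phi>: "\<psi> (\<phi> x) = x" "\<phi> x \<in> cantor_set" if "x \<in> ?X" for x
    using h that by (auto simp: homeomorphism_def)
  define T where "T g = \<phi> \<circ> (translate g \<circ> \<psi>)" for g
  have T\<phi>: "T g (\<phi> x) = \<phi> (translate g x)" if "x \<in> ?X" for g x using \<psi>\<phi>(1)[OF that] by (simp add: T_def)
  have T_0: "T 0 z = z" if "z \<in> cantor_set" for z using \<phi>\<psi>(1)[OF that] by (simp add: T_def translate_0)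
  have T_add: "T (g + k) z = T g (T k z)" if "z \<in> cantor_set" for g k z
    using \<psi>\<phi>(1)[OF translate_phase_space[OF \<phi>\<psi>(2)[OF that]], of k] by (simp add: T_def translate_add)
  have T_homeo: "\<exists>S. homeomorphism cantor_set cantor_set (T g) S" for g
    using homeomorphism_compose[OF homeomorphism_compose[OF homeomorphism_symD[OF h] homeomorphism_translate] h]
    unfolding T_def by blast
  have action: "homeo_action T cantor_set"
    unfolding homeo_action_def using T_homeo T_0 T_add by blast
  have compact: "compact cantor_set"
    using compact_continuous_image[OF continuous_ternary compact_UNIV_fun_bool] by (simp add: range_ternary)
  have dense: "cantor_set \<times> cantor_set \<subseteq> closure (range (\<lambda>g. (T g z1, T g z2)))"
    if z: "z1 \<in> cantor_set" "z2 \<in> cantor_set" and orb: "action_orbit T z1 \<noteq> action_orbit T z2" for z1 z2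
  proof -
    obtain p1 where p1: "phases p1" "\<psi> z1 = bits p1" using phase_spaceD[OF \<phi>\<psi>(2)[OF z(1)]] by blast
    obtain p2 where p2: "phases p2" "\<psi> z2 = bits p2" using phase_spaceD[OF \<phi>\<psi>(2)[OF z(2)]] by blast
    \<comment> \<open>Such a translation would put both points on one orbit, so
      \<open>pair_dichotomy\<close> leaves the dense alternative.\<close>
    have "\<not> (\<exists>\<rho>. \<forall>n u. vcong n (p2 n u) (p1 n (u + \<rho>)))"
    proof
      assume "\<exists>\<rho>. \<forall>n u. vcong n (p2 n u) (p1 n (u + \<rho>))"
      then obtain \<rho> where "\<forall>n u. vcong n (p2 n u) (p1 n (u + \<rho>))" by blast
      then have "bits p2 = bits (\<lambda>n u. p1 n (u + \<rho>))" by (simp add: bits_eq)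
      then have "\<psi> z2 = translate \<rho> (\<psi> z1)" using p1 p2 by (simp add: translate_bits)
      then have e: "z2 = T \<rho> z1" using \<phi>\<psi>(1)[OF z(2)] by (simp add: T_def)
      have "T g z2 = T (g + \<rho>) z1" for g using T_add[OF z(1), of g \<rho>] e by simp
      then have "action_orbit T z2 = range ((\<lambda>g. T g z1) \<circ> (\<lambda>g. g + \<rho>))" by (simp add: action_orbit_def comp_def)
      also have "\<dots> = action_orbit T z1"
        unfolding image_comp[symmetric] action_orbit_def using surj_plus_right[of \<rho>] by simp
      finally show False using orb by simp
    qed
    then have dich: "\<exists>g. \<forall>n\<le>l. \<forall>u. (\<forall>k. \<bar>u $ k\<bar> \<le> R) \<longrightarrow>
       vcong n (p1 n (u + g)) (base n (u + t1)) \<and> vcong n (p2 n (u + g)) (base n (u + t2))" for l R t1 t2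
      using pair_dichotomy[OF p1(1) p2(1)] by blast
    show ?thesis
    proof
      fix ab assume "ab \<in> cantor_set \<times> cantor_set"
      then obtain a b where ab: "ab = (a, b)" "a \<in> cantor_set" "b \<in> cantor_set" by blast
      show "ab \<in> closure (range (\<lambda>g. (T g z1, T g z2)))"
      proof (rule ccontr)
        assume "ab \<notin> closure (range (\<lambda>g. (T g z1, T g z2)))"
        then have "open (- closure (range (\<lambda>g. (T g z1, T g z2))))" "(a, b) \<in> - closure (range (\<lambda>g. (T g z1, T g z2)))"
          using ab by auto
        then obtain A B where AB: "open A" "open B" "(a, b) \<in> A \<times> B"
            "A \<times> B \<subseteq> - closure (range (\<lambda>g. (T g z1, T g z2)))"
          by (rule open_prod_elim)
        \<comment> \<open>Pulled back along \<open>\<phi>\<close>, a neighbourhood of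
          \<open>c\<close> is secured by agreement with \<open>\<psi> c\<close> on finitely many
          bits.\<close>
        have near: "\<exists>K. finite K \<and> (\<forall>x\<in>?X. (\<forall>i\<in>K. x i = \<psi> c i) \<longrightarrow> \<phi> x \<in> A')"
          if "open A'" "c \<in> A'" "c \<in> cantor_set" for A' c
        proof -
          have "continuous_on ?X \<phi>" using h by (simp add: homeomorphism_def)
          then obtain U where U: "open U" "\<psi> c \<in> U" "\<forall>x\<in>?X. x \<in> U \<longrightarrow> \<phi> x \<in> A'"
            unfolding continuous_on_topological using \<open>open A'\<close> \<open>c \<in> A'\<close> \<phi>\<psi>[OF \<open>c \<in> cantor_set\<close>] by metis
          obtain K where "finite K" "{f. \<forall>i\<in>K. f i = \<psi> c i} \<subseteq> U" using open_fun_cylinder[OF U(1,2)] by blast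
          then show ?thesis using U(3) by blast
        qed
        obtain K1 where K1: "finite K1" "\<forall>x\<in>?X. (\<forall>i\<in>K1. x i = \<psi> a i) \<longrightarrow> \<phi> x \<in> A"
          using near[of A a] AB ab by auto
        obtain K2 where K2: "finite K2" "\<forall>x\<in>?X. (\<forall>i\<in>K2. x i = \<psi> b i) \<longrightarrow> \<phi> x \<in> B"
          using near[of B b] AB ab by auto
        obtain pa where pa: "phases pa" "\<psi> a = bits pa" using phase_spaceD[OF \<phi>\<psi>(2)[OF ab(2)]] by blast
        obtain pb where pb: "phases pb" "\<psi> b = bits pb" using phase_spaceD[OF \<phi>\<psi>(2)[OF ab(3)]] by blast
        obtain N R where K: "\<And>n u \<theta>. (n, u, \<theta>) \<in> K1 \<union> K2 \<Longrightarrow> n \<le> N \<and> (\<forall>k. \<bar>u $ k\<bar> \<le> R)"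
          using finite_window[of "K1 \<union> K2"] K1(1) K2(1) by blast
        \<comment> \<open>On the relevant finite window the targets \<open>a\<close> and
          \<open>b\<close> look like \<open>base\<close> translated by \<open>t1\<close> and
          \<open>t2\<close>, so it suffices to bring the pair to these two translates at
          once.\<close>
        obtain t1 where t1: "\<And>n u. n \<le> N \<Longrightarrow> (\<And>k. \<bar>u $ k\<bar> \<le> R) \<Longrightarrow> vcong n (pa n u) (base n (u + t1))"
          using phasesE[OF pa(1)] by blast
        obtain t2 where t2: "\<And>n u. n \<le> N \<Longrightarrow> (\<And>k. \<bar>u $ k\<bar> \<le> R) \<Longrightarrow> vcong n (pb n u) (base n (u + t2))"
          using phasesE[OF pb(1)] by blast
        obtain g where g: "\<forall>n\<le>N. \<forall>u. (\<forall>k. \<bar>u $ k\<bar> \<le> R) \<longrightarrow>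
            vcong n (p1 n (u + g)) (base n (u + t1)) \<and> vcong n (p2 n (u + g)) (base n (u + t2))"
          using dich by blast
        have "\<forall>i\<in>K1. bits (\<lambda>n u. p1 n (u + g)) i = bits pa i"
        proof (rule bits_agree)
          fix n u \<theta> assume "(n, u, \<theta>) \<in> K1"
          then have nu: "n \<le> N" "\<forall>k. \<bar>u $ k\<bar> \<le> R" using K[of n u \<theta>] by simp_all
          have "vcong n (p1 n (u + g)) (base n (u + t1))" using g nu by blast
          moreover have "vcong n (pa n u) (base n (u + t1))" by (rule t1) (use nu in auto)
          ultimately show "vcong n (p1 n (u + g)) (pa n u)" by (meson vcong_sym vcong_trans)
        qed
        then have "\<phi> (translate g (\<psi> z1)) \<in> A"
          using K1(2) pa(2) p1 bits_in_phase_space[OF phases_shift[OF p1(1)]] by (simp add: translate_bits)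
        moreover have "\<forall>i\<in>K2. bits (\<lambda>n u. p2 n (u + g)) i = bits pb i"
        proof (rule bits_agree)
          fix n u \<theta> assume "(n, u, \<theta>) \<in> K2"
          then have nu: "n \<le> N" "\<forall>k. \<bar>u $ k\<bar> \<le> R" using K[of n u \<theta>] by simp_all
          have "vcong n (p2 n (u + g)) (base n (u + t2))" using g nu by blast
          moreover have "vcong n (pb n u) (base n (u + t2))" by (rule t2) (use nu in auto)
          ultimately show "vcong n (p2 n (u + g)) (pb n u)" by (meson vcong_sym vcong_trans)
        qed
        then have "\<phi> (translate g (\<psi> z2)) \<in> B"
          using K2(2) pb(2) p2 bits_in_phase_space[OF phases_shift[OF p2(1)]] by (simp add: translate_bits)
        ultimately have "(T g z1, T g z2) \<in> A \<times> B" by (simp add: T_def)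
        then have "(T g z1, T g z2) \<notin> closure (range (\<lambda>g. (T g z1, T g z2)))"
          using subsetD[OF AB(4)] by simp
        moreover have "(T g z1, T g z2) \<in> closure (range (\<lambda>g. (T g z1, T g z2)))"
          by (rule subsetD[OF closure_subset rangeI])
        ultimately show False by contradiction
      qed
    qed
  qed
  have "faithful_action T cantor_set"
    unfolding faithful_action_def
  proof (intro allI impI notI)
    fix g :: "int ^ 'd" assume g: "g \<noteq> 0" and same: "\<forall>z\<in>cantor_set. T g z = z"
    have b: "bits base \<in> ?X" by (rule bits_in_phase_space[OF phases_base])
    then have "\<phi> (translate g (bits base)) = \<phi> (bits base)" using same \<psi>\<phi>(2)[OF b] T\<phi>[OF b, of g] by simp
    then have "translate g (bits base) = bits base" using \<psi>\<phi>(1) b translate_phase_space by metis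
    then show False using phases_free[OF phases_base g] by (simp add: translate_bits bits_eq)
  qed
  moreover have "doubly_minimal T cantor_set"
    unfolding doubly_minimal_def using compact action infinite_cantor_set dense by blast
  ultimately show ?thesis by blast
qed

end
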